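(* Let $\Omega\subset\mathbb{R}^2$ be a convex compact domain, and let $w_x$ and $w_y$ be, respectively, the lengths of the horizontal and of the vertical sides of the rectangle circumscribed around $\Omega$ with sides parallel to the coordinate axes. Then $$K_1(\Omega)\;=\;\sup_{u\in\mathcal{U}_\Omega,\ u\neq 0}\ \frac{\|u_x\|_1}{\|u_y\|_1}\;\le\; 2\,\frac{w_y}{w_x}.$$ Moreover, this inequality is an equality if and only if $\Omega$ contains a vertical segment (a segment parallel to the $y$-axis) with its ends on the two horizontal sides of the circumscribed rectangle.
   Context: A convex compact domain is a compact convex set $\Omega\subset\mathbb{R}^2$ with nonempty interior. $\mathcal{U}_\Omega$ denotes the class of continuous concave functions $u:\Omega\to\mathbb{R}$ with $u|_{\partial\Omega}=0$ whose gradient $\nabla u=(u_x,u_y)$ is uniformly bounded over all interior points of $\Omega$ at which it is defined (it is defined almost everywhere). $\|f\|_1=\int_\Omega |f|\,dx\,dy$. The circumscribed rectangle is the smallest rectangle with sides parallel to the axes containing $\Omega$. *)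

theory Defs
  imports "HOL-Analysis.Analysis"
begin

definition convex_compact_domain :: "(real \<times> real) set \<Rightarrow> bool" where
  "convex_compact_domain \<Omega> \<longleftrightarrow> convex \<Omega> \<and> compact \<Omega> \<and> interior \<Omega> \<noteq> {}"

definition partial_x :: "(real \<times> real \<Rightarrow> real) \<Rightarrow> real \<times> real \<Rightarrow> real" where
  "partial_x u p = deriv (\<lambda>t. u (t, snd p)) (fst p)"

definition partial_y :: "(real \<times> real \<Rightarrow> real) \<Rightarrow> real \<times> real \<Rightarrow> real" where
  "partial_y u p = deriv (\<lambda>t. u (fst p, t)) (snd p)"

definition gradient_exists :: "(real \<times> real \<Rightarrow> real) \<Rightarrow> real \<times> real \<Rightarrow> bool" where
  "gradient_exists u p \<longleftrightarrow>
     (\<lambda>t. u (t, snd p)) field_differentiable (at (fst p)) \<and>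
     (\<lambda>t. u (fst p, t)) field_differentiable (at (snd p))"

text \<open>Members are total functions, but only their values on \<open>\<Omega>\<close> are constrained.\<close>

definition U_class :: "(real \<times> real) set \<Rightarrow> (real \<times> real \<Rightarrow> real) set" where
  "U_class \<Omega> = {u. continuous_on \<Omega> u \<and> concave_on \<Omega> u \<and> (\<forall>p\<in>frontier \<Omega>. u p = 0) \<and>
     (\<exists>M. \<forall>p\<in>interior \<Omega>. gradient_exists u p \<longrightarrow> norm (partial_x u p, partial_y u p) \<le> M)}"

text \<open>
  The integral is taken with respect to the complete measure \<open>lebesgue\<close>: \<open>partial_x u\<close> and
  \<open>partial_y u\<close> have unspecified values at non-differentiability points and may depend on
  values of \<open>u\<close> outside \<open>\<Omega>\<close> at points of \<open>frontier \<Omega>\<close>. For \<open>u \<in> U_class \<Omega>\<close> both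
  sets of points are negligible.
\<close>

definition L1_norm :: "(real \<times> real) set \<Rightarrow> (real \<times> real \<Rightarrow> real) \<Rightarrow> real" where
  "L1_norm \<Omega> f = set_lebesgue_integral lebesgue \<Omega> (\<lambda>p. \<bar>f p\<bar>)"

text \<open>The supremum is taken in \<open>ereal\<close>, so that an upper bound on it includes its finiteness.\<close>

definition K1 :: "(real \<times> real) set \<Rightarrow> ereal" where
  "K1 \<Omega> = (SUP u\<in>{u \<in> U_class \<Omega>. \<exists>p\<in>\<Omega>. u p \<noteq> 0}.
     ereal (L1_norm \<Omega> (partial_x u) / L1_norm \<Omega> (partial_y u)))"

text \<open>\<open>cbox a b\<close> is the axis-parallel rectangle with lower left corner \<open>a\<close> and upper right
  corner \<open>b\<close>.\<close>

definition circumscribed_rectangle ::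
  "(real \<times> real) set \<Rightarrow> real \<times> real \<Rightarrow> real \<times> real \<Rightarrow> bool" where
  "circumscribed_rectangle \<Omega> a b \<longleftrightarrow>
     \<Omega> \<subseteq> cbox a b \<and> (\<forall>c d. \<Omega> \<subseteq> cbox c d \<longrightarrow> cbox a b \<subseteq> cbox c d)"

lemma circumscribed_rectangle_ex1:
  assumes "convex_compact_domain \<Omega>"
  shows "\<exists>!(a, b). circumscribed_rectangle \<Omega> a b"
proof -
  have cpt: "compact \<Omega>" and ne: "\<Omega> \<noteq> {}"
    using assms interior_subset[of \<Omega>] by (auto simp: convex_compact_domain_def)
  have c1: "compact (fst ` \<Omega>)" and c2: "compact (snd ` \<Omega>)"
    using cpt by (auto intro!: compact_continuous_image continuous_intros)
  obtain p1 where p1: "p1 \<in> \<Omega>" "\<And>p. p \<in> \<Omega> \<Longrightarrow> fst p1 \<le> fst p"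
    using compact_attains_inf[OF c1] ne by auto
  obtain p2 where p2: "p2 \<in> \<Omega>" "\<And>p. p \<in> \<Omega> \<Longrightarrow> fst p \<le> fst p2"
    using compact_attains_sup[OF c1] ne by auto
  obtain q1 where q1: "q1 \<in> \<Omega>" "\<And>p. p \<in> \<Omega> \<Longrightarrow> snd q1 \<le> snd p"
    using compact_attains_inf[OF c2] ne by auto
  obtain q2 where q2: "q2 \<in> \<Omega>" "\<And>p. p \<in> \<Omega> \<Longrightarrow> snd p \<le> snd q2"
    using compact_attains_sup[OF c2] ne by auto
  have box: "p \<in> cbox a b \<longleftrightarrow> fst a \<le> fst p \<and> fst p \<le> fst b \<and> snd a \<le> snd p \<and> snd p \<le> snd b"
    for p a b :: "real \<times> real"
    by (cases p; cases a; cases b) (auto simp: cbox_Pair_eq)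
  have ex: "circumscribed_rectangle \<Omega> (fst p1, snd q1) (fst p2, snd q2)"
    unfolding circumscribed_rectangle_def subset_eq box
    using p1 p2 q1 q2 by (auto intro: order_trans)
  have uniq: "a = c \<and> b = d"
    if "circumscribed_rectangle \<Omega> a b" "circumscribed_rectangle \<Omega> c d" for a b c d
  proof -
    have eq: "cbox a b = cbox c d"
      using that unfolding circumscribed_rectangle_def by (intro equalityI) (simp_all only:)
    have "cbox a b \<noteq> {}"
      using that(1) ne by (auto simp: circumscribed_rectangle_def)
    with eq show ?thesis
      by (simp add: eq_cbox)
  qed
  show ?thesis
    using ex uniq by (intro ex1I[of _ "((fst p1, snd q1), (fst p2, snd q2))"]) auto
qed

text \<open>A vertical segment in \<open>\<Omega>\<close> joining the lower and the upper side of \<open>cbox a b\<close>.\<close>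

definition has_full_vertical_segment ::
  "(real \<times> real) set \<Rightarrow> real \<times> real \<Rightarrow> real \<times> real \<Rightarrow> bool" where
  "has_full_vertical_segment \<Omega> a b \<longleftrightarrow>
     (\<exists>p\<in>closed_segment a (fst b, snd a). \<exists>q\<in>closed_segment (fst a, snd b) b.
        fst p = fst q \<and> closed_segment p q \<subseteq> \<Omega>)"

end

theory Submission
  imports Defs
begin

text \<open>
  Extend $u$ by 0 outside $\<Omega>$. On a horizontal line $u$ is concave between two zeros, so it rises
  to its maximum and falls back; the integral of $|u_x|$ along the line is therefore twice the
  maximum $M(y)$ of $u$ on it. By Tonelli, $\<parallel>u_x\<parallel>_1 = 2\<integral>M(y) dy$
  (\<open>L1_norm_partial_x_eq\<close>), and in the same way $\<parallel>u_y\<parallel>_1 = 2\<integral>N(x) dx$ with the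
  maximum $N(x)$ of $u$ on a vertical line. The problem is thus reduced to comparing two concave
  functions of one variable with the common maximum $m$ of $u$.

  Clearly $\<integral>M \<le> m w_y$, and concavity gives $\<integral>N \<ge> m w_x/2$, since the graph of $N$ lies above a
  triangle of height $m$ over an interval of length $w_x$ (\<open>ridge_integral_ratio_bounds\<close>). The
  quotient is the asserted bound.

  For near equality $M$ must be close to $m$ near both ends of its interval, so $u$ has high points
  near both horizontal sides of the rectangle, and $N$ must be close to a triangle, so these points
  have nearly the same abscissa. If $\<Omega>$ contains no full vertical segment, compactness keeps the two
  requirements apart by a fixed amount, which bounds the quotient away from the constant for all
  $u$ at once (\<open>no_full_segment_ratio_gap\<close>). If $\<Omega>$ does contain such a segment, the minimum of
  a tent with its apex near the abscissa of the segment and a steep multiple of the distance to the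
  complement of $\<Omega>$ comes arbitrarily close to equality (\<open>near_extremal_function\<close>).

  Behind the formula for $\<parallel>u_x\<parallel>_1$ is the fact that a concave function of one variable is almost
  everywhere differentiable and the integral of its derivative. Both follow from the monotonicity of
  difference quotients by dominated convergence (\<open>has_integral_quotient_limit\<close>).
\<close>

section \<open>One-sided derivatives of concave functions\<close>

text \<open>
  One-sided derivatives taken along the steps $1/(n+1)$ only: as limits of sequences they are Borel
  functions whenever $f$ is one, and for concave $f$ the difference quotients are monotone in the
  step, so that nothing is lost.
\<close>

definition right_deriv :: "(real \<Rightarrow> real) \<Rightarrow> real \<Rightarrow> real" where
  "right_deriv f x = lim (\<lambda>n. (f (x + inverse (real (Suc n))) - f x) / inverse (real (Suc n)))"

definition left_deriv :: "(real \<Rightarrow> real) \<Rightarrow> real \<Rightarrow> real" where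
  "left_deriv f x = lim (\<lambda>n. (f (x - inverse (real (Suc n))) - f x) / (- inverse (real (Suc n))))"

lemma concave_slopes:
  fixes f :: "real \<Rightarrow> real"
  assumes "concave_on S f" "x \<in> S" "z \<in> S" "x < y" "y < z"
  shows "(f z - f x) / (z - x) \<le> (f y - f x) / (y - x)"
    and "(f z - f y) / (z - y) \<le> (f z - f x) / (z - x)"
proof -
  have c: "convex_on S (\<lambda>x. - f x)"
    using assms(1) by (simp add: concave_on_def)
  have "(- f x - - f y) / (x - y) \<le> (- f x - - f z) / (x - z)"
    and "(- f x - - f z) / (x - z) \<le> (- f y - - f z) / (y - z)"
    using convex_on_slope_le[OF c assms(2,3,4,5)] by auto
  moreover have "(- f x - - f y) / (x - y) = - ((f y - f x) / (y - x))"
    "(- f x - - f z) / (x - z) = - ((f z - f x) / (z - x))"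
    "(- f y - - f z) / (y - z) = - ((f z - f y) / (z - y))"
    by (simp_all add: minus_divide_right)
  ultimately show "(f z - f x) / (z - x) \<le> (f y - f x) / (y - x)"
    "(f z - f y) / (z - y) \<le> (f z - f x) / (z - x)"
    by linarith+
qed

text \<open>
  The step may have either sign, so this contains both the existence of the one-sided derivatives
  and the inequality between them.
\<close>

lemma concave_quotient_antimono:
  fixes f :: "real \<Rightarrow> real"
  assumes f: "concave_on {l..r} f" and x: "l < x" "x < r"
    and h: "h \<noteq> 0" "k \<noteq> 0" "h \<le> k" "l \<le> x + h" "x + k \<le> r"
  shows "(f (x + k) - f x) / k \<le> (f (x + h) - f x) / h"
proof -
  consider "h = k" | "h < k" "0 < h" | "h < k" "k < 0" | "h < 0" "0 < k"
    using h by linarith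
  then show ?thesis
  proof cases
    case 2
    then show ?thesis
      using concave_slopes(1)[OF f, of x "x + k" "x + h"] x h by auto
  next
    case 3
    have "(f x - f (x + k)) / (x - (x + k)) \<le> (f x - f (x + h)) / (x - (x + h))"
      using concave_slopes(2)[OF f, of "x + h" x "x + k"] 3 x h by auto
    moreover have "(f x - f (x + k)) / (x - (x + k)) = (f (x + k) - f x) / k"
      "(f x - f (x + h)) / (x - (x + h)) = (f (x + h) - f x) / h"
      using h by (auto simp: divide_simps)
    ultimately show ?thesis by simp
  next
    case 4
    have "(f (x + k) - f x) / (x + k - x) \<le> (f (x + k) - f (x + h)) / (x + k - (x + h))"
      "(f (x + k) - f (x + h)) / (x + k - (x + h)) \<le> (f x - f (x + h)) / (x - (x + h))"
      using concave_slopes[OF f, of "x + h" "x + k" x] 4 x h by auto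
    moreover have "(f x - f (x + h)) / (x - (x + h)) = (f (x + h) - f x) / h"
      using h by (auto simp: divide_simps)
    ultimately show ?thesis by simp
  qed simp
qed

lemma antimono_onesided_limits:
  fixes q :: "real \<Rightarrow> real"
  assumes e: "e > 0"
    and q: "\<And>h k. \<lbrakk>h \<noteq> 0; k \<noteq> 0; - e \<le> h; h \<le> k; k \<le> e\<rbrakk> \<Longrightarrow> q k \<le> q h"
  obtains R L where "(q \<longlongrightarrow> R) (at_right 0)" "(q \<longlongrightarrow> L) (at_left 0)" "R \<le> L"
    "\<And>h. 0 < h \<Longrightarrow> h \<le> e \<Longrightarrow> q h \<le> R" "\<And>h. - e \<le> h \<Longrightarrow> h < 0 \<Longrightarrow> L \<le> q h"
proof
  define R where "R = Sup (q ` {0<..e})"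
  define L where "L = Inf (q ` {-e..<0})"
  have bR: "bdd_above (q ` {0<..e})"
    using q[of "-e"] e by (intro bdd_aboveI2[where M = "q (-e)"]) auto
  have bL: "bdd_below (q ` {-e..<0})"
    using q[of _ e] e by (intro bdd_belowI2[where m = "q e"]) auto
  show 1: "q h \<le> R" if "0 < h" "h \<le> e" for h
    unfolding R_def using that bR by (intro cSup_upper) auto
  show 2: "L \<le> q h" if "- e \<le> h" "h < 0" for h
    unfolding L_def using that bL by (intro cInf_lower) auto
  show "R \<le> L"
    unfolding R_def L_def using e
    by (intro cSup_least cInf_greatest) (auto intro!: q)
  show "(q \<longlongrightarrow> R) (at_right 0)"
  proof (rule order_tendstoI)
    fix a assume "a < R"
    then obtain h where h: "0 < h" "h \<le> e" "a < q h"
      using less_cSup_iff[OF _ bR, of a] e unfolding R_def by auto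
    have "\<forall>\<^sub>F k in at_right 0. 0 < k \<and> k < h"
      using eventually_at_right_real[OF h(1)] by simp
    then show "\<forall>\<^sub>F k in at_right 0. a < q k"
    proof (rule eventually_mono)
      fix k assume "0 < k \<and> k < h"
      then have "q h \<le> q k" using h e by (intro q) auto
      then show "a < q k" using h by simp
    qed
  next
    fix a assume a: "R < a"
    have "\<forall>\<^sub>F k in at_right 0. 0 < k \<and> k < e"
      using eventually_at_right_real[OF e] by simp
    then show "\<forall>\<^sub>F k in at_right 0. q k < a"
      by (rule eventually_mono) (use 1 a in force)
  qed
  show "(q \<longlongrightarrow> L) (at_left 0)"
  proof (rule order_tendstoI)
    fix a assume "L < a"
    then obtain h where h: "-e \<le> h" "h < 0" "q h < a"
      using cInf_less_iff[OF _ bL, of a] e unfolding L_def by auto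
    have "\<forall>\<^sub>F k in at_left 0. h < k \<and> k < 0"
      using eventually_at_left_real[OF h(2)] by simp
    then show "\<forall>\<^sub>F k in at_left 0. q k < a"
    proof (rule eventually_mono)
      fix k assume "h < k \<and> k < 0"
      then have "q k \<le> q h" using h e by (intro q) auto
      then show "q k < a" using h by simp
    qed
  next
    fix a assume a: "a < L"
    have "\<forall>\<^sub>F k in at_left 0. -e < k \<and> k < 0"
      using eventually_at_left_real[of "- e" 0] e by simp
    then show "\<forall>\<^sub>F k in at_left 0. a < q k"
      by (rule eventually_mono) (use 2 a in \<open>auto intro: less_le_trans\<close>)
  qed
qed

lemma concave_onesided_derivs:
  fixes f :: "real \<Rightarrow> real"
  assumes f: "concave_on {l..r} f" and x: "l < x" "x < r"
  shows right_quotients_tendsto: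
      "(\<lambda>n. (f (x + inverse (real (Suc n))) - f x) / inverse (real (Suc n))) \<longlonglongrightarrow> right_deriv f x"
    and left_quotients_tendsto:
      "(\<lambda>n. (f (x - inverse (real (Suc n))) - f x) / (- inverse (real (Suc n)))) \<longlonglongrightarrow> left_deriv f x"
    and right_le_left_deriv: "right_deriv f x \<le> left_deriv f x"
    and right_quotient_le: "\<And>y. x < y \<Longrightarrow> y \<le> r \<Longrightarrow> (f y - f x) / (y - x) \<le> right_deriv f x"
    and left_quotient_ge: "\<And>y. l \<le> y \<Longrightarrow> y < x \<Longrightarrow> left_deriv f x \<le> (f y - f x) / (y - x)"
    and onesided_eq_imp_DERIV:
      "left_deriv f x = right_deriv f x \<Longrightarrow> (f has_field_derivative right_deriv f x) (at x)"
proof -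
  define q where "q h = (f (x + h) - f x) / h" for h
  have anti: "q k \<le> q h" if "h \<noteq> 0" "k \<noteq> 0" "h \<le> k" "l \<le> x + h" "x + k \<le> r" for h k
    unfolding q_def by (rule concave_quotient_antimono[OF f x that])
  define e where "e = min (x - l) (r - x)"
  have e: "e > 0" "e \<le> x - l" "e \<le> r - x" using x by (auto simp: e_def)
  obtain R L where RL: "(q \<longlongrightarrow> R) (at_right 0)" "(q \<longlongrightarrow> L) (at_left 0)" "R \<le> L"
    "\<And>h. 0 < h \<Longrightarrow> h \<le> e \<Longrightarrow> q h \<le> R" "\<And>h. - e \<le> h \<Longrightarrow> h < 0 \<Longrightarrow> L \<le> q h"
    by (rule antimono_onesided_limits[OF e(1), of q]) (use anti e in auto)
  have pos: "filterlim (\<lambda>n. inverse (real (Suc n))) (at_right 0) sequentially"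
    using LIMSEQ_inverse_real_of_nat
    by (auto simp: filterlim_at intro!: always_eventually)
  have neg: "filterlim (\<lambda>n. - inverse (real (Suc n))) (at_left 0) sequentially"
    using tendsto_minus[OF LIMSEQ_inverse_real_of_nat]
    by (auto simp: filterlim_at intro!: always_eventually)
  have r: "(\<lambda>n. q (inverse (real (Suc n)))) \<longlonglongrightarrow> R"
    by (rule filterlim_compose[OF RL(1) pos])
  have l: "(\<lambda>n. q (- inverse (real (Suc n)))) \<longlonglongrightarrow> L"
    by (rule filterlim_compose[OF RL(2) neg])
  have R: "right_deriv f x = R"
    using limI[OF r] unfolding right_deriv_def q_def .
  have L: "left_deriv f x = L"
    using limI[OF l] unfolding left_deriv_def q_def by simp
  show "(\<lambda>n. (f (x + inverse (real (Suc n))) - f x) / inverse (real (Suc n))) \<longlonglongrightarrow> right_deriv f x"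
    using r unfolding R q_def .
  show "(\<lambda>n. (f (x - inverse (real (Suc n))) - f x) / (- inverse (real (Suc n)))) \<longlonglongrightarrow> left_deriv f x"
    using l unfolding L q_def by simp
  show "right_deriv f x \<le> left_deriv f x"
    using RL(3) R L by simp
  show "(f y - f x) / (y - x) \<le> right_deriv f x" if y: "x < y" "y \<le> r" for y
  proof -
    have "q (y - x) \<le> q (min e (y - x))"
      using y e x by (intro anti) (auto simp: min_def)
    also have "\<dots> \<le> R" using y e by (intro RL(4)) auto
    finally show ?thesis by (simp add: q_def R)
  qed
  show "left_deriv f x \<le> (f y - f x) / (y - x)" if y: "l \<le> y" "y < x" for y
  proof -
    have "L \<le> q (max (- e) (y - x))" using y e by (intro RL(5)) auto
    also have "\<dots> \<le> q (y - x)"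
      using y e x by (intro anti) (auto simp: max_def)
    finally show ?thesis by (simp add: q_def L)
  qed
  show "(f has_field_derivative right_deriv f x) (at x)" if "left_deriv f x = right_deriv f x"
  proof -
    have "(q \<longlongrightarrow> R) (at 0)"
      using RL(1,2) that R L by (intro filterlim_split_at) simp_all
    then show ?thesis by (simp add: DERIV_def R q_def[abs_def])
  qed
qed

section \<open>The integral of the derivative of a concave function\<close>

text \<open>
  The fundamental theorem of calculus for a one-sided derivative, without any knowledge of where
  $f$ is differentiable. If $F' = f$, then the difference quotient of $f$ with step $h$ is the
  derivative of the difference quotient of $F$, so its integral over $[\<alpha>,\<beta>]$ tends to
  $f(\<beta>) - f(\<alpha>)$ as $h \<rightarrow> 0$. By monotonicity in the step all quotients lie between those
  with the fixed steps $\<plusminus> e$, which are continuous and serve as dominating functions.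
\<close>

lemma has_integral_quotient_limit:
  fixes f g :: "real \<Rightarrow> real" and h :: "nat \<Rightarrow> real"
  assumes f: "concave_on {l..r} f" "continuous_on UNIV f"
    and ab: "l < \<alpha>" "\<alpha> \<le> \<beta>" "\<beta> < r"
    and h: "\<And>n. h n \<noteq> 0" "h \<longlonglongrightarrow> 0"
    and g: "\<And>x. \<alpha> \<le> x \<Longrightarrow> x \<le> \<beta> \<Longrightarrow> (\<lambda>n. (f (x + h n) - f x) / h n) \<longlonglongrightarrow> g x"
  shows "(g has_integral (f \<beta> - f \<alpha>)) {\<alpha>..\<beta>}"
proof -
  define e where "e = min (\<alpha> - l) (r - \<beta>)"
  have e: "e > 0" "e \<le> \<alpha> - l" "e \<le> r - \<beta>" using ab by (auto simp: e_def)
  obtain N where N: "\<And>n. n \<ge> N \<Longrightarrow> \<bar>h n\<bar> < e"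
    using h(2) e(1) unfolding LIMSEQ_iff by auto
  obtain F where "\<forall>x. (F has_vector_derivative f x) (at x)"
    using einterval_antiderivative[of "-\<infinity>" "\<infinity>" f] f(2)
    by (auto simp: continuous_on_eq_continuous_at)
  then have F: "(F has_real_derivative f x) (at x)" for x
    by (simp add: has_real_derivative_iff_has_vector_derivative)
  define q where "q k x = (f (x + k) - f x) / k" for k x
  define G where "G k x = (F (x + k) - F x) / k" for k x
  have G: "(q k has_integral (G k \<beta> - G k \<alpha>)) {\<alpha>..\<beta>}" for k
  proof (rule fundamental_theorem_of_calculus[OF ab(2)])
    fix x
    have "((\<lambda>x. F (x + k)) has_real_derivative f (x + k)) (at x)"
      using F[of "x + k"] by (simp add: DERIV_shift)
    then have "(G k has_real_derivative q k x) (at x)"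
      unfolding G_def[abs_def] q_def by (intro DERIV_cdivide DERIV_diff F)
    then show "(G k has_vector_derivative q k x) (at x within {\<alpha>..\<beta>})"
      by (simp add: has_real_derivative_iff_has_vector_derivative has_vector_derivative_at_within)
  qed
  have Glim: "(\<lambda>n. G (h n) x) \<longlonglongrightarrow> f x" for x
  proof -
    have "filterlim h (at 0) sequentially" using h by (simp add: filterlim_at)
    then show ?thesis
      using filterlim_compose[OF F[of x, unfolded DERIV_def]] by (simp add: G_def)
  qed
  have "q k integrable_on {\<alpha>..\<beta>}" for k using G by blast
  moreover have "(\<lambda>x. \<bar>q e x\<bar> + \<bar>q (- e) x\<bar>) integrable_on {\<alpha>..\<beta>}"
    unfolding q_def using e(1)
    by (intro integrable_continuous_real continuous_intros continuous_on_compose2[OF f(2)]) auto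
  moreover have "norm (q (h (n + N)) x) \<le> \<bar>q e x\<bar> + \<bar>q (- e) x\<bar>" if "x \<in> {\<alpha>..\<beta>}" for n x
  proof -
    have "\<bar>h (n + N)\<bar> < e" by (rule N) simp
    then have "q e x \<le> q (h (n + N)) x"
      unfolding q_def using that e ab h(1)[of "n + N"]
      by (intro concave_quotient_antimono[OF f(1)]) auto
    moreover have "q (h (n + N)) x \<le> q (- e) x"
      unfolding q_def using that e ab h(1)[of "n + N"] \<open>\<bar>h (n + N)\<bar> < e\<close>
      by (intro concave_quotient_antimono[OF f(1)]) auto
    ultimately show ?thesis by simp
  qed
  moreover have "(\<lambda>n. q (h (n + N)) x) \<longlonglongrightarrow> g x" if "x \<in> {\<alpha>..\<beta>}" for x
    using LIMSEQ_ignore_initial_segment[OF g[of x], of N] that by (simp add: q_def)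
  ultimately have *: "g integrable_on {\<alpha>..\<beta>}"
      "(\<lambda>n. integral {\<alpha>..\<beta>} (q (h (n + N)))) \<longlonglongrightarrow> integral {\<alpha>..\<beta>} g"
    using dominated_convergence[of "\<lambda>n. q (h (n + N))" "{\<alpha>..\<beta>}"] by blast+
  have "(\<lambda>n. integral {\<alpha>..\<beta>} (q (h (n + N)))) = (\<lambda>n. G (h (n + N)) \<beta> - G (h (n + N)) \<alpha>)"
    using integral_unique[OF G] by simp
  moreover have "(\<lambda>n. G (h (n + N)) \<beta> - G (h (n + N)) \<alpha>) \<longlonglongrightarrow> f \<beta> - f \<alpha>"
    by (intro tendsto_diff LIMSEQ_ignore_initial_segment[OF Glim])
  ultimately have "integral {\<alpha>..\<beta>} g = f \<beta> - f \<alpha>"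
    using *(2) LIMSEQ_unique by metis
  with *(1) show ?thesis by (metis integrable_integral)
qed

lemma concave_ftc:
  fixes f :: "real \<Rightarrow> real"
  assumes f: "concave_on {l..r} f" "continuous_on UNIV f"
    and ab: "l < \<alpha>" "\<alpha> \<le> \<beta>" "\<beta> < r"
  shows has_integral_right_deriv: "(right_deriv f has_integral (f \<beta> - f \<alpha>)) {\<alpha>..\<beta>}"
    and has_integral_left_deriv: "(left_deriv f has_integral (f \<beta> - f \<alpha>)) {\<alpha>..\<beta>}"
proof -
  show "(right_deriv f has_integral (f \<beta> - f \<alpha>)) {\<alpha>..\<beta>}"
    using LIMSEQ_inverse_real_of_nat right_quotients_tendsto[OF f(1)] ab
    by (intro has_integral_quotient_limit[OF f ab, of "\<lambda>n. inverse (real (Suc n))"]) auto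
  show "(left_deriv f has_integral (f \<beta> - f \<alpha>)) {\<alpha>..\<beta>}"
    using tendsto_minus[OF LIMSEQ_inverse_real_of_nat] left_quotients_tendsto[OF f(1)] ab
    by (intro has_integral_quotient_limit[OF f ab, of "\<lambda>n. - inverse (real (Suc n))"]) auto
qed

lemma borel_measurable_onesided_derivs [measurable]:
  fixes f :: "real \<Rightarrow> real"
  assumes [measurable]: "f \<in> borel_measurable borel"
  shows "right_deriv f \<in> borel_measurable borel" "left_deriv f \<in> borel_measurable borel"
  unfolding right_deriv_def[abs_def] left_deriv_def[abs_def] by measurable

text \<open>
  Both one-sided derivatives have the same integral over every compact subinterval and one
  dominates the other; hence they agree almost everywhere, and with them the function is almost
  everywhere differentiable.
\<close>

lemma AE_left_deriv_eq_right_deriv: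
  fixes f :: "real \<Rightarrow> real"
  assumes f: "concave_on {l..r} f" "continuous_on UNIV f"
  shows "AE x in lborel. x \<in> {l<..<r} \<longrightarrow> left_deriv f x = right_deriv f x"
proof -
  have [measurable]: "f \<in> borel_measurable borel"
    by (rule borel_measurable_continuous_onI[OF f(2)])
  have 1: "AE x in lborel. x \<in> {\<alpha>..\<beta>} \<longrightarrow> left_deriv f x = right_deriv f x"
    if ab: "l < \<alpha>" "\<beta> < r" for \<alpha> \<beta>
  proof (cases "\<alpha> \<le> \<beta>")
    case True
    have "((\<lambda>x. left_deriv f x - right_deriv f x) has_integral 0) {\<alpha>..\<beta>}"
      using has_integral_diff[OF concave_ftc(2,1)[OF f ab(1) True ab(2)]] by simp
    then have "(\<integral>\<^sup>+x. ennreal (left_deriv f x - right_deriv f x) * indicator {\<alpha>..\<beta>} x \<partial>lborel) = ennreal 0"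
      using right_le_left_deriv[OF f(1)] ab
      by (intro nn_integral_has_integral_lebesgue') auto
    then have "AE x in lborel. ennreal (left_deriv f x - right_deriv f x) * indicator {\<alpha>..\<beta>} x = 0"
      by (subst (asm) ennreal_0, subst (asm) nn_integral_0_iff_AE) auto
    then show ?thesis
    proof eventually_elim
      case (elim x)
      show ?case
      proof
        assume x: "x \<in> {\<alpha>..\<beta>}"
        then have "left_deriv f x \<le> right_deriv f x"
          using elim by (simp add: ennreal_eq_0_iff)
        moreover have "right_deriv f x \<le> left_deriv f x"
          using x ab by (intro right_le_left_deriv[OF f(1)]) auto
        ultimately show "left_deriv f x = right_deriv f x" by simp
      qed
    qed
  qed auto
  have "AE x in lborel. \<forall>n. x \<in> {l + inverse (real (Suc n))..r - inverse (real (Suc n))}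
      \<longrightarrow> left_deriv f x = right_deriv f x"
    by (subst AE_all_countable, intro allI, rule 1) auto
  then show ?thesis
  proof eventually_elim
    case (elim x)
    show ?case
    proof
      assume "x \<in> {l<..<r}"
      then have "0 < min (x - l) (r - x)" by simp
      from reals_Archimedean[OF this] obtain n where "inverse (real (Suc n)) < min (x - l) (r - x)" ..
      then show "left_deriv f x = right_deriv f x"
        using elim by (auto dest!: spec[of _ n])
    qed
  qed
qed

text \<open>
  The function rises from 0 to its maximum and falls back to 0, so its total variation is twice the
  maximum. The slopes may be unbounded at the ends, hence the exhaustion by compact intervals
  around the maximum point $m$.
\<close>

lemma nn_integral_abs_right_deriv:
  fixes f :: "real \<Rightarrow> real"
  assumes f: "concave_on {l..r} f" "continuous_on UNIV f"
    and ends: "f l = 0" "f r = 0"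
    and m: "l < m" "m < r" "\<And>x. l \<le> x \<Longrightarrow> x \<le> r \<Longrightarrow> f x \<le> f m"
  shows "(\<integral>\<^sup>+x. ennreal \<bar>right_deriv f x\<bar> * indicator {l<..<r} x \<partial>lborel) = ennreal (2 * f m)"
proof -
  have [measurable]: "f \<in> borel_measurable borel"
    by (rule borel_measurable_continuous_onI[OF f(2)])
  have up: "0 \<le> right_deriv f x" if "l < x" "x < m" for x
  proof -
    have "0 \<le> (f m - f x) / (m - x)" using that m by simp
    also have "\<dots> \<le> right_deriv f x"
      using that m by (intro right_quotient_le[OF f(1)]) auto
    finally show ?thesis .
  qed
  have down: "right_deriv f x \<le> 0" if "m \<le> x" "x < r" for x
  proof -
    have "right_deriv f x \<le> left_deriv f x"
      using that m by (intro right_le_left_deriv[OF f(1)]) auto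
    moreover have "left_deriv f x \<le> 0" if "m < x"
    proof -
      have "left_deriv f x \<le> (f m - f x) / (m - x)"
        using \<open>x < r\<close> that m by (intro left_quotient_ge[OF f(1)]) auto
      also have "\<dots> \<le> 0" using \<open>x < r\<close> that m by (simp add: divide_nonneg_neg)
      finally show ?thesis .
    qed
    moreover have "right_deriv f m \<le> 0"
    proof (rule tendsto_upperbound[OF right_quotients_tendsto[OF f(1) m(1,2)]])
      have "\<forall>\<^sub>F n in sequentially. inverse (real (Suc n)) < r - m"
        using LIMSEQ_inverse_real_of_nat m(2) by (intro order_tendstoD(2)) auto
      then show "\<forall>\<^sub>F n in sequentially.
          (f (m + inverse (real (Suc n))) - f m) / inverse (real (Suc n)) \<le> 0"
      proof eventually_elim
        case (elim n)
        moreover have "0 < inverse (real (Suc n))" by simp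
        ultimately have "f (m + inverse (real (Suc n))) \<le> f m"
          using m(1) by (intro m(3)) linarith+
        then show ?case by (intro divide_nonpos_pos) auto
      qed
    qed simp
    ultimately show ?thesis using that by (cases "x = m") auto
  qed
  define \<alpha> where "\<alpha> k = l + (m - l) * inverse (real (Suc k))" for k
  define \<beta> where "\<beta> k = r - (r - m) * inverse (real (Suc k))" for k
  have ab: "l < \<alpha> k" "\<alpha> k \<le> m" "m \<le> \<beta> k" "\<beta> k < r" for k
  proof -
    have i: "0 < inverse (real (Suc k))" "inverse (real (Suc k)) \<le> 1"
      by (simp_all add: inverse_le_1_iff)
    have "(m - l) * inverse (real (Suc k)) \<le> m - l" "(r - m) * inverse (real (Suc k)) \<le> r - m"
      using mult_left_mono[OF i(2), of "m - l"] mult_left_mono[OF i(2), of "r - m"] m(1,2) by auto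
    moreover have "0 < (m - l) * inverse (real (Suc k))" "0 < (r - m) * inverse (real (Suc k))"
      using m(1,2) i(1) by (auto intro!: mult_pos_pos)
    ultimately show "l < \<alpha> k" "\<alpha> k \<le> m" "m \<le> \<beta> k" "\<beta> k < r"
      by (auto simp: \<alpha>_def \<beta>_def)
  qed
  have lim: "\<alpha> \<longlonglongrightarrow> l" "\<beta> \<longlonglongrightarrow> r"
    unfolding \<alpha>_def[abs_def] \<beta>_def[abs_def]
    using tendsto_add[OF tendsto_const[of l] tendsto_mult_right_zero[OF LIMSEQ_inverse_real_of_nat]]
      tendsto_diff[OF tendsto_const[of r] tendsto_mult_right_zero[OF LIMSEQ_inverse_real_of_nat]]
    by simp_all
  have mono: "\<alpha> k \<le> \<alpha> j" "\<beta> j \<le> \<beta> k" if "j \<le> k" for j k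
    unfolding \<alpha>_def \<beta>_def using that m
    by (auto intro!: mult_left_mono add_left_mono diff_left_mono le_imp_inverse_le)
  have piece: "(\<integral>\<^sup>+x. ennreal \<bar>right_deriv f x\<bar> * indicator {\<alpha> k..\<beta> k} x \<partial>lborel)
      = ennreal (2 * f m - f (\<alpha> k) - f (\<beta> k))" for k
  proof (rule nn_integral_has_integral_lebesgue')
    \<comment> \<open>At a corner $m$ the right derivative may already be negative, so that point has to be spiked out.\<close>
    have "((\<lambda>x. \<bar>right_deriv f x\<bar>) has_integral (f m - f (\<alpha> k))) {\<alpha> k..m}"
    proof (rule has_integral_spike_finite[of "{m}"])
      show "(right_deriv f has_integral (f m - f (\<alpha> k))) {\<alpha> k..m}"
        using ab[of k] m by (intro has_integral_right_deriv[OF f]) auto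
    qed (use up ab[of k] in auto)
    moreover have "((\<lambda>x. \<bar>right_deriv f x\<bar>) has_integral - (f (\<beta> k) - f m)) {m..\<beta> k}"
    proof (rule has_integral_eq)
      show "((\<lambda>x. - right_deriv f x) has_integral - (f (\<beta> k) - f m)) {m..\<beta> k}"
        using ab[of k] m by (intro has_integral_neg has_integral_right_deriv[OF f]) auto
      show "- right_deriv f x = \<bar>right_deriv f x\<bar>" if "x \<in> {m..\<beta> k}" for x
        using down[of x] that ab[of k] by auto
    qed
    ultimately show "((\<lambda>x. \<bar>right_deriv f x\<bar>) has_integral (2 * f m - f (\<alpha> k) - f (\<beta> k))) {\<alpha> k..\<beta> k}"
      using has_integral_combine[OF ab(2,3)[of k]] by (fastforce simp: algebra_simps)
  qed simp
  have "(\<lambda>k. \<integral>\<^sup>+x. ennreal \<bar>right_deriv f x\<bar> * indicator {\<alpha> k..\<beta> k} x \<partial>lborel)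
      \<longlonglongrightarrow> (\<integral>\<^sup>+x. ennreal \<bar>right_deriv f x\<bar> * indicator {l<..<r} x \<partial>lborel)"
  proof (rule nn_integral_LIMSEQ)
    show "incseq (\<lambda>k x. ennreal \<bar>right_deriv f x\<bar> * indicator {\<alpha> k..\<beta> k} x)"
      using mono by (fastforce simp: incseq_def le_fun_def indicator_def intro: order_trans)
    show "(\<lambda>k. ennreal \<bar>right_deriv f x\<bar> * indicator {\<alpha> k..\<beta> k} x)
        \<longlonglongrightarrow> ennreal \<bar>right_deriv f x\<bar> * indicator {l<..<r} x" for x
    proof (rule tendsto_eventually, cases "l < x \<and> x < r")
      case True
      then have "\<forall>\<^sub>F k in sequentially. \<alpha> k < x" "\<forall>\<^sub>F k in sequentially. x < \<beta> k"
        using order_tendstoD[OF lim(1)] order_tendstoD[OF lim(2)] by auto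
      then show "\<forall>\<^sub>F k in sequentially. ennreal \<bar>right_deriv f x\<bar> * indicator {\<alpha> k..\<beta> k} x
          = ennreal \<bar>right_deriv f x\<bar> * indicator {l<..<r} x"
        by eventually_elim (use True in \<open>auto simp: indicator_def\<close>)
    next
      case False
      then have "x \<notin> {\<alpha> k..\<beta> k}" for k using ab[of k] by auto
      then show "\<forall>\<^sub>F k in sequentially. ennreal \<bar>right_deriv f x\<bar> * indicator {\<alpha> k..\<beta> k} x
          = ennreal \<bar>right_deriv f x\<bar> * indicator {l<..<r} x"
        using False by (auto simp: indicator_def)
    qed
  qed simp
  moreover have "(\<lambda>k. ennreal (2 * f m - f (\<alpha> k) - f (\<beta> k))) \<longlonglongrightarrow> ennreal (2 * f m)"
  proof (rule tendsto_ennrealI)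
    have "(\<lambda>k. f (\<alpha> k)) \<longlonglongrightarrow> f l" "(\<lambda>k. f (\<beta> k)) \<longlonglongrightarrow> f r"
      using f(2) lim by (auto intro: continuous_on_tendsto_compose)
    then show "(\<lambda>k. 2 * f m - f (\<alpha> k) - f (\<beta> k)) \<longlonglongrightarrow> 2 * f m"
      using ends by (auto intro!: tendsto_eq_intros)
  qed
  ultimately show ?thesis
    unfolding piece by (rule LIMSEQ_unique)
qed

section \<open>Horizontal slices of a concave bump\<close>

text \<open>
  For a nonnegative function that vanishes outside $\<Omega>$, the supremum over a whole horizontal line
  is the maximum over the section of $\<Omega>$ by that line, and it is 0 off the projection of $\<Omega>$.
\<close>

definition ridge :: "(real \<times> real \<Rightarrow> real) \<Rightarrow> real \<Rightarrow> real" where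
  "ridge v y = (SUP x. v (x, y))"

definition right_partial_x :: "(real \<times> real \<Rightarrow> real) \<Rightarrow> real \<times> real \<Rightarrow> real" where
  "right_partial_x v p = right_deriv (\<lambda>x. v (x, snd p)) (fst p)"

definition left_partial_x :: "(real \<times> real \<Rightarrow> real) \<Rightarrow> real \<times> real \<Rightarrow> real" where
  "left_partial_x v p = left_deriv (\<lambda>x. v (x, snd p)) (fst p)"

text \<open>
  Members of \<open>U_class \<Omega>\<close> become such functions when they are extended by 0 outside $\<Omega>$. Since they
  vanish on the frontier, the extension is continuous on the whole plane, so that slices and
  difference quotients can be formed without reference to $\<Omega>$.
\<close>

locale concave_bump =
  fixes \<Omega> :: "(real \<times> real) set" and v :: "real \<times> real \<Rightarrow> real"
  assumes domain: "convex_compact_domain \<Omega>"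
    and continuous: "continuous_on UNIV v"
    and concave: "concave_on \<Omega> v"
    and zero_outside: "p \<notin> interior \<Omega> \<Longrightarrow> v p = 0"
begin

lemma convex_domain: "convex \<Omega>" and compact_domain: "compact \<Omega>"
  and interior_nonempty: "interior \<Omega> \<noteq> {}"
  using domain by (simp_all add: convex_compact_domain_def)

lemma concaveD:
  "\<lbrakk>p \<in> \<Omega>; q \<in> \<Omega>; 0 \<le> s; 0 \<le> t; s + t = 1\<rbrakk> \<Longrightarrow> s * v p + t * v q \<le> v (s *\<^sub>R p + t *\<^sub>R q)"
  using concave by (simp add: concave_on_iff)

lemma zero_outside_domain: "p \<notin> \<Omega> \<Longrightarrow> v p = 0"
  using zero_outside[of p] interior_subset[of \<Omega>] by blast

text \<open>
  Every point of $\<Omega>$ is a convex combination of frontier points, where the function vanishes.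
\<close>

lemma nonneg: "0 \<le> v p"
proof (cases "p \<in> \<Omega>")
  case True
  have "convex {p \<in> \<Omega>. 0 \<le> v p}"
  proof (rule convexI)
    fix x y and s t :: real
    assume xy: "x \<in> {p \<in> \<Omega>. 0 \<le> v p}" "y \<in> {p \<in> \<Omega>. 0 \<le> v p}" and st: "0 \<le> s" "0 \<le> t" "s + t = 1"
    have "0 \<le> s * v x + t * v y" using xy st by simp
    also have "\<dots> \<le> v (s *\<^sub>R x + t *\<^sub>R y)"
      using xy st by (intro concaveD) auto
    finally show "s *\<^sub>R x + t *\<^sub>R y \<in> {p \<in> \<Omega>. 0 \<le> v p}"
      using xy st convexD[OF convex_domain] by auto
  qed
  moreover have "frontier \<Omega> \<subseteq> {p \<in> \<Omega>. 0 \<le> v p}"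
    using zero_outside compact_imp_closed[OF compact_domain] by (auto simp: frontier_def)
  ultimately have "convex hull (frontier \<Omega>) \<subseteq> {p \<in> \<Omega>. 0 \<le> v p}"
    by (rule hull_minimal[rotated])
  then show ?thesis
    using True Krein_Milman_frontier[OF convex_domain compact_domain] by auto
next
  case False
  then show ?thesis by (simp add: zero_outside_domain)
qed

lemma bounded_above: obtains B where "\<And>p. v p \<le> B" "0 \<le> B"
proof -
  have "\<Omega> \<noteq> {}" using interior_nonempty interior_subset[of \<Omega>] by auto
  then obtain p where p: "\<And>q. q \<in> \<Omega> \<Longrightarrow> v q \<le> v p"
    using continuous_attains_sup[OF compact_domain _ continuous_on_subset[OF continuous subset_UNIV]]
    by blast
  have "v q \<le> v p" for q
    using p[of q] zero_outside_domain[of q] nonneg[of p] by (cases "q \<in> \<Omega>") auto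
  then show ?thesis using that nonneg[of p] by blast
qed

lemma le_ridge: "v (x, y) \<le> ridge v y"
proof -
  obtain B where "\<And>p. v p \<le> B" using bounded_above by blast
  then show ?thesis unfolding ridge_def by (intro cSUP_upper bdd_aboveI2) auto
qed

lemma ridge_nonneg: "0 \<le> ridge v y"
  using nonneg le_ridge order_trans by blast

lemma ridge_leI: "(\<And>x. (x, y) \<in> interior \<Omega> \<Longrightarrow> v (x, y) \<le> c) \<Longrightarrow> 0 \<le> c \<Longrightarrow> ridge v y \<le> c"
  unfolding ridge_def by (rule cSUP_least) (auto, metis zero_outside)

lemma compact_slice: "compact {x. (x, y) \<in> \<Omega>}"
proof -
  have "{x. (x, y) \<in> \<Omega>} = fst ` (\<Omega> \<inter> (UNIV \<times> {y}))" by force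
  moreover have "compact (\<Omega> \<inter> (UNIV \<times> {y}))"
    using compact_domain by (intro compact_Int_closed closed_Times) auto
  ultimately show ?thesis
    by (simp add: compact_continuous_image continuous_on_fst continuous_on_id)
qed

lemma continuous_slice: "continuous_on UNIV (\<lambda>x. v (x, y))"
  by (intro continuous_on_compose2[OF continuous]) (auto intro!: continuous_intros)

lemma ridge_attained:
  assumes "y \<in> snd ` \<Omega>"
  obtains x where "(x, y) \<in> \<Omega>" "ridge v y = v (x, y)"
proof -
  have "{x. (x, y) \<in> \<Omega>} \<noteq> {}" using assms by auto
  then obtain x where x: "(x, y) \<in> \<Omega>" "\<And>x'. (x', y) \<in> \<Omega> \<Longrightarrow> v (x', y) \<le> v (x, y)"
    using continuous_attains_sup[OF compact_slice _ continuous_on_subset[OF continuous_slice subset_UNIV]]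
    by blast
  have "ridge v y \<le> v (x, y)"
    using x(2) nonneg interior_subset[of \<Omega>] by (intro ridge_leI) auto
  then show ?thesis using that[OF x(1)] le_ridge[of x y] by simp
qed

lemma ridge_zero_outside: "y \<notin> snd ` \<Omega> \<Longrightarrow> ridge v y = 0"
proof -
  assume "y \<notin> snd ` \<Omega>"
  then have "(x, y) \<notin> \<Omega>" for x by force
  then show ?thesis
    using ridge_nonneg[of y] zero_outside_domain by (intro antisym ridge_leI) auto
qed

text \<open>
  The hypograph of the ridge is a projection of the hypograph of the bump.
\<close>

lemma concave_ridge: "concave_on (snd ` \<Omega>) (ridge v)"
  unfolding concave_on_iff
proof (intro conjI ballI allI impI)
  show "convex (snd ` \<Omega>)"
    using convex_domain by (intro convex_linear_image) (auto intro: linear_snd)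
  fix y z s t :: real
  assume yz: "y \<in> snd ` \<Omega>" "z \<in> snd ` \<Omega>" and st: "0 \<le> s" "0 \<le> t" "s + t = 1"
  obtain a where a: "(a, y) \<in> \<Omega>" "ridge v y = v (a, y)" using ridge_attained[OF yz(1)] .
  obtain b where b: "(b, z) \<in> \<Omega>" "ridge v z = v (b, z)" using ridge_attained[OF yz(2)] .
  have "s * ridge v y + t * ridge v z \<le> v (s *\<^sub>R (a, y) + t *\<^sub>R (b, z))"
    unfolding a(2) b(2) by (rule concaveD[OF a(1) b(1) st])
  also have "\<dots> \<le> ridge v (s *\<^sub>R y + t *\<^sub>R z)" by (simp add: le_ridge)
  finally show "s * ridge v y + t * ridge v z \<le> ridge v (s *\<^sub>R y + t *\<^sub>R z)" .
qed

text \<open>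
  Each horizontal slice is an instance of the one-dimensional situation: it vanishes at both ends of
  an interval and is concave in between.
\<close>

lemma interior_slice_cases:
  obtains (empty) "\<And>x. (x, y) \<notin> interior \<Omega>"
  | (interval) l r where "l < r" "\<And>x. (x, y) \<in> interior \<Omega> \<longleftrightarrow> x \<in> {l<..<r}"
      "concave_on {l..r} (\<lambda>x. v (x, y))" "v (l, y) = 0" "v (r, y) = 0"
proof (cases "\<exists>x. (x, y) \<in> interior \<Omega>")
  case True
  define S where "S = {x. (x, y) \<in> interior \<Omega>}"
  have "S = (\<lambda>x. (x, y)) -` interior \<Omega>" by (auto simp: S_def)
  then have "open S" by (auto intro!: open_vimage continuous_intros)
  moreover have "convex S"
  proof (rule convexI)
    fix a b s t :: real
    assume "a \<in> S" "b \<in> S" and st: "0 \<le> s" "0 \<le> t" "s + t = 1"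
    then have "s *\<^sub>R (a, y) + t *\<^sub>R (b, y) \<in> interior \<Omega>"
      by (intro convexD[OF convex_interior[OF convex_domain]]) (auto simp: S_def)
    moreover have "s * y + t * y = y" using st(3) by (metis distrib_right mult_1)
    ultimately show "s *\<^sub>R a + t *\<^sub>R b \<in> S" by (simp add: S_def)
  qed
  moreover have sub: "closure S \<subseteq> {x. (x, y) \<in> \<Omega>}"
    using compact_imp_closed[OF compact_slice] interior_subset by (intro closure_minimal) (auto simp: S_def)
  moreover have "bounded S"
    using bounded_subset[OF compact_imp_bounded[OF compact_slice]] sub closure_subset by blast
  ultimately have "interior (closure S) = S" "convex (closure S)" "compact (closure S)"
    using convex_interior_closure[of S] by (auto simp: interior_open convex_closure)
  moreover obtain l r where lr: "closure S = {l..r}"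
    using \<open>convex (closure S)\<close> \<open>compact (closure S)\<close>
    by (metis connected_compact_interval_1 convex_connected box_real(2))
  ultimately have S: "S = {l<..<r}" by (metis box_real interior_cbox)
  have "S \<noteq> {}" using True by (auto simp: S_def)
  then have "l < r" by (simp add: S)
  have "concave_on {l..r} (\<lambda>x. v (x, y))"
    unfolding concave_on_iff
  proof (intro conjI ballI allI impI)
    fix a b s t :: real
    assume ab: "a \<in> {l..r}" "b \<in> {l..r}" and st: "0 \<le> s" "0 \<le> t" "s + t = 1"
    then have "(a, y) \<in> \<Omega>" "(b, y) \<in> \<Omega>" using sub lr by auto
    then have "s * v (a, y) + t * v (b, y) \<le> v (s *\<^sub>R (a, y) + t *\<^sub>R (b, y))"
      using st by (rule concaveD)
    moreover have "s * y + t * y = y" using st(3) by (metis distrib_right mult_1)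
    ultimately show "s * v (a, y) + t * v (b, y) \<le> v (s *\<^sub>R a + t *\<^sub>R b, y)" by simp
  qed simp
  moreover have "(l, y) \<notin> interior \<Omega>" "(r, y) \<notin> interior \<Omega>"
    using S by (auto simp: S_def set_eq_iff)
  ultimately show ?thesis
    using interval[OF \<open>l < r\<close>] S zero_outside by (auto simp: S_def set_eq_iff)
qed (use empty in blast)

lemma nn_integral_slice:
  "(\<integral>\<^sup>+x. ennreal \<bar>right_partial_x v (x, y)\<bar> * indicator (interior \<Omega>) (x, y) \<partial>lborel)
    = ennreal (2 * ridge v y)"
proof (cases rule: interior_slice_cases[of y])
  case empty
  then have "ridge v y = 0" using ridge_nonneg[of y] by (intro antisym ridge_leI) auto
  then show ?thesis using empty by simp
next
  case (interval l r)
  have "\<exists>m\<in>{l<..<r}. \<forall>x\<in>{l..r}. v (x, y) \<le> v (m, y)"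
  proof -
    obtain m where m: "m \<in> {l..r}" "\<forall>x\<in>{l..r}. v (x, y) \<le> v (m, y)"
      using continuous_attains_sup[OF compact_Icc _ continuous_on_subset[OF continuous_slice subset_UNIV], of l r y]
        interval(1) by auto
    show ?thesis
    proof (cases "m \<in> {l<..<r}")
      \<comment> \<open>A maximum at an end means that the slice vanishes, and then any inner point will do.\<close>
      case False
      then have "v (m, y) = 0" using m(1) interval(4,5) by (auto simp: less_le)
      then show ?thesis
        using m(2) nonneg interval(1) by (intro bexI[of _ "(l + r) / 2"]) (auto intro: order_trans)
    qed (use m in blast)
  qed
  then obtain m where m: "l < m" "m < r" "\<And>x. l \<le> x \<Longrightarrow> x \<le> r \<Longrightarrow> v (x, y) \<le> v (m, y)"
    by auto
  have "ridge v y \<le> v (m, y)"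
    using m interval(2) nonneg by (intro ridge_leI) auto
  then have "ridge v y = v (m, y)" using le_ridge by (intro antisym)
  moreover have "(\<integral>\<^sup>+x. ennreal \<bar>right_partial_x v (x, y)\<bar> * indicator (interior \<Omega>) (x, y) \<partial>lborel)
      = (\<integral>\<^sup>+x. ennreal \<bar>right_deriv (\<lambda>x. v (x, y)) x\<bar> * indicator {l<..<r} x \<partial>lborel)"
    using interval(2) by (intro nn_integral_cong) (auto simp: right_partial_x_def indicator_def)
  ultimately show ?thesis
    using nn_integral_abs_right_deriv[OF interval(3) continuous_slice interval(4,5) m] by simp
qed

lemma AE_slice:
  "AE x in lborel. (x, y) \<in> interior \<Omega> \<longrightarrow> left_partial_x v (x, y) = right_partial_x v (x, y)"
proof (cases rule: interior_slice_cases[of y])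
  case (interval l r)
  then show ?thesis
    using AE_left_deriv_eq_right_deriv[OF interval(3) continuous_slice]
    by (simp add: right_partial_x_def left_partial_x_def)
qed simp

lemma onesided_eq_imp_DERIV_slice:
  assumes "(x, y) \<in> interior \<Omega>" "left_partial_x v (x, y) = right_partial_x v (x, y)"
  shows "((\<lambda>t. v (t, y)) has_field_derivative right_partial_x v (x, y)) (at x)"
proof (cases rule: interior_slice_cases[of y])
  case (interval l r)
  then show ?thesis
    using onesided_eq_imp_DERIV[OF interval(3), of x] assms
    by (simp add: right_partial_x_def left_partial_x_def)
qed (use assms in auto)

lemma right_le_left_slice:
  assumes "(x, y) \<in> interior \<Omega>"
  shows "right_partial_x v (x, y) \<le> left_partial_x v (x, y)"
proof (cases rule: interior_slice_cases[of y])
  case (interval l r)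
  then show ?thesis
    using right_le_left_deriv[OF interval(3), of x] assms
    by (simp add: right_partial_x_def left_partial_x_def)
qed (use assms in auto)

lemma borel_measurable_onesided_partials [measurable]:
  "right_partial_x v \<in> borel_measurable borel" "left_partial_x v \<in> borel_measurable borel"
proof -
  have shift: "(\<lambda>p. v (fst p + c, snd p)) \<in> borel_measurable borel" for c
    by (intro borel_measurable_continuous_onI continuous_on_compose2[OF continuous])
      (auto intro!: continuous_intros)
  show "right_partial_x v \<in> borel_measurable borel" "left_partial_x v \<in> borel_measurable borel"
    unfolding right_partial_x_def[abs_def] left_partial_x_def[abs_def] right_deriv_def left_deriv_def
    using shift shift[of 0] shift[of "- c" for c]
    by (auto intro!: borel_measurable_lim_metric borel_measurable_divide borel_measurable_diff)
qed

lemma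
  shows nn_integral_right_partial_x:
      "(\<integral>\<^sup>+p. ennreal (\<bar>right_partial_x v p\<bar> * indicator (interior \<Omega>) p) \<partial>lborel)
        = (\<integral>\<^sup>+y. ennreal (2 * ridge v y) \<partial>lborel)"
    and borel_measurable_ridge [measurable]: "ridge v \<in> borel_measurable borel"
proof -
  have [measurable]: "interior \<Omega> \<in> sets borel" by simp
  have m: "(\<lambda>p. ennreal (\<bar>right_partial_x v p\<bar> * indicator (interior \<Omega>) p))
      \<in> borel_measurable (lborel \<Otimes>\<^sub>M lborel)"
    unfolding lborel_prod by measurable
  have *: "(\<integral>\<^sup>+x. ennreal (\<bar>right_partial_x v (x, y)\<bar> * indicator (interior \<Omega>) (x, y)) \<partial>lborel)
      = ennreal (2 * ridge v y)" for y
    by (subst nn_integral_slice[symmetric]) (auto intro!: nn_integral_cong simp: indicator_def)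
  show "(\<integral>\<^sup>+p. ennreal (\<bar>right_partial_x v p\<bar> * indicator (interior \<Omega>) p) \<partial>lborel)
        = (\<integral>\<^sup>+y. ennreal (2 * ridge v y) \<partial>lborel)"
    using lborel_pair.nn_integral_snd[OF m] by (simp add: * lborel_prod)
  have "(\<lambda>y. \<integral>\<^sup>+x. ennreal (\<bar>right_partial_x v (x, y)\<bar> * indicator (interior \<Omega>) (x, y)) \<partial>lborel)
      \<in> borel_measurable lborel"
    using m by measurable
  then have "(\<lambda>y. enn2real (ennreal (2 * ridge v y)) / 2) \<in> borel_measurable lborel"
    unfolding * by measurable
  then show "ridge v \<in> borel_measurable borel"
    using ridge_nonneg by simp
qed

text \<open>
  Tonelli's theorem lifts the slicewise statement to the plane; for this the set in question is
  written with the Borel functions \<open>left_partial_x v\<close> and \<open>right_partial_x v\<close>.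
\<close>

lemma AE_left_eq_right_partial:
  "AE p in lborel. p \<in> interior \<Omega> \<longrightarrow> left_partial_x v p = right_partial_x v p"
proof -
  have [measurable]: "interior \<Omega> \<in> sets borel" by simp
  define D where "D p = ennreal ((left_partial_x v p - right_partial_x v p) * indicator (interior \<Omega>) p)" for p
  have m: "D \<in> borel_measurable (lborel \<Otimes>\<^sub>M lborel)"
    unfolding lborel_prod D_def[abs_def] by measurable
  have "(\<integral>\<^sup>+x. D (x, y) \<partial>lborel) = 0" for y
  proof -
    have "AE x in lborel. D (x, y) = 0"
      using AE_slice[of y] by eventually_elim (auto simp: D_def indicator_def)
    then have "(\<integral>\<^sup>+x. D (x, y) \<partial>lborel) = (\<integral>\<^sup>+x. 0 \<partial>(lborel :: real measure))"
      by (rule nn_integral_cong_AE)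
    then show ?thesis by simp
  qed
  then have "integral\<^sup>N lborel D = 0"
    using lborel_pair.nn_integral_snd[OF m] by (simp add: lborel_prod)
  then have "AE p in lborel. D p = 0"
    using m by (subst (asm) nn_integral_0_iff_AE) (auto simp: lborel_prod)
  then show ?thesis
  proof eventually_elim
    case (elim p)
    show ?case
    proof
      assume p: "p \<in> interior \<Omega>"
      then have "left_partial_x v p \<le> right_partial_x v p"
        using elim by (simp add: D_def ennreal_eq_0_iff)
      moreover have "right_partial_x v p \<le> left_partial_x v p"
        using right_le_left_slice[of "fst p" "snd p"] p by simp
      ultimately show "left_partial_x v p = right_partial_x v p" by simp
    qed
  qed
qed

lemma integrable_ridge: "integrable lborel (ridge v)"
proof -
  obtain B where B: "\<And>p. v p \<le> B" "0 \<le> B" using bounded_above by blast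
  have "compact (snd ` \<Omega>)"
    by (intro compact_continuous_image compact_domain continuous_intros)
  then have "integrable lborel (\<lambda>y. B * indicator (snd ` \<Omega>) y)"
    by (intro integrable_mult_right integrable_real_indicator)
      (auto simp: borel_compact intro!: emeasure_compact_finite[unfolded infinity_ennreal_def])
  then show ?thesis
  proof (rule Bochner_Integration.integrable_bound)
    show "AE y in lborel. norm (ridge v y) \<le> norm (B * indicator (snd ` \<Omega>) y)"
      using ridge_nonneg ridge_zero_outside B
      by (auto intro!: AE_I2 ridge_leI simp: indicator_def abs_mult)
  qed simp
qed

text \<open>
  The key identity: integrating the total variation of the slices, which is twice the height of the
  ridge, gives $\<parallel>u_x\<parallel>_1$. Integrability of $u_x$ is part of what has to be shown, because the
  integral of a non-integrable function is 0 by convention.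
\<close>

theorem L1_norm_partial_x_eq:
  assumes eq: "\<And>p. p \<in> interior \<Omega> \<Longrightarrow> u p = v p"
  shows "L1_norm \<Omega> (partial_x u) = 2 * integral\<^sup>L lborel (ridge v)"
proof -
  define G where "G p = \<bar>right_partial_x v p\<bar> * indicator (interior \<Omega>) p" for p
  have [measurable]: "interior \<Omega> \<in> sets borel" by simp
  have [measurable]: "G \<in> borel_measurable borel" unfolding G_def[abs_def] by measurable
  have "(\<integral>\<^sup>+p. ennreal (G p) \<partial>lborel) = (\<integral>\<^sup>+y. ennreal (2 * ridge v y) \<partial>lborel)"
    unfolding G_def by (rule nn_integral_right_partial_x)
  also have "\<dots> = ennreal (\<integral>y. 2 * ridge v y \<partial>lborel)"
    using integrable_ridge ridge_nonneg by (intro nn_integral_eq_integral) auto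
  finally have nn: "(\<integral>\<^sup>+p. ennreal (G p) \<partial>lborel) = ennreal (2 * integral\<^sup>L lborel (ridge v))"
    by simp
  have G0: "0 \<le> G p" for p by (simp add: G_def)
  have int0: "0 \<le> integral\<^sup>L lborel (ridge v)"
    using ridge_nonneg by (intro integral_nonneg_AE) auto
  have hG: "integrable lborel G"
    using nn G0 by (intro integrableI_nonneg) auto
  have iG: "integral\<^sup>L lborel G = 2 * integral\<^sup>L lborel (ridge v)"
    using nn G0 int0 by (subst integral_eq_nn_integral) auto
  have ind: "indicator \<Omega> p *\<^sub>R G p = G p" for p
    using interior_subset by (auto simp: G_def indicator_def)
  have GO: "G absolutely_integrable_on \<Omega>"
    unfolding set_integrable_def ind using hG by (simp add: integrable_completion)
  obtain N where N: "N \<in> null_sets lborel"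
    "\<And>p. p \<in> interior \<Omega> \<Longrightarrow> p \<notin> N \<Longrightarrow> left_partial_x v p = right_partial_x v p"
    using AE_left_eq_right_partial by (elim AE_E3) auto
  have neg: "negligible (N \<union> frontier \<Omega>)"
    using N(1) negligible_convex_frontier[OF convex_domain]
    by (auto simp: negligible_iff_null_sets null_sets_completionI)
  have spike: "\<bar>partial_x u p\<bar> = G p" if "p \<in> \<Omega> - (N \<union> frontier \<Omega>)" for p
  proof -
    obtain x y where p: "p = (x, y)" by (cases p)
    have i: "(x, y) \<in> interior \<Omega>"
      using that closure_subset[of \<Omega>] by (auto simp: p frontier_def)
    have "((\<lambda>t. v (t, y)) has_field_derivative right_partial_x v (x, y)) (at x)"
      using onesided_eq_imp_DERIV_slice[OF i] N(2)[of "(x, y)"] that i by (auto simp: p)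
    moreover have "open {t. (t, y) \<in> interior \<Omega>}"
    proof -
      have "{t. (t, y) \<in> interior \<Omega>} = (\<lambda>t. (t, y)) -` interior \<Omega>" by auto
      then show ?thesis by (auto intro!: open_vimage continuous_intros)
    qed
    ultimately have "((\<lambda>t. u (t, y)) has_field_derivative right_partial_x v (x, y)) (at x)"
      using i eq by (elim has_field_derivative_transform_within_open) auto
    then have "partial_x u (x, y) = right_partial_x v (x, y)"
      by (simp add: partial_x_def DERIV_imp_deriv)
    then show ?thesis using i by (simp add: p G_def)
  qed
  have "(\<lambda>p. \<bar>partial_x u p\<bar>) absolutely_integrable_on \<Omega>"
    by (rule absolutely_integrable_spike[OF GO neg spike])
  then have "L1_norm \<Omega> (partial_x u) = integral \<Omega> (\<lambda>p. \<bar>partial_x u p\<bar>)"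
    unfolding L1_norm_def by (rule set_lebesgue_integral_eq_integral(2))
  also have "\<dots> = integral \<Omega> G"
    by (rule integral_spike[OF neg]) (use spike in auto)
  also have "\<dots> = integral\<^sup>L lebesgue G"
    using set_lebesgue_integral_eq_integral(2)[OF GO] unfolding set_lebesgue_integral_def ind by simp
  also have "\<dots> = integral\<^sup>L lborel G"
    by (rule integral_completion) simp
  finally show ?thesis using iG by simp
qed

end

section \<open>Exchanging the coordinates\<close>

lemma
  shows measurable_lebesgue_swap: "(prod.swap :: real \<times> real \<Rightarrow> _) \<in> lebesgue \<rightarrow>\<^sub>M lebesgue"
    and distr_lebesgue_swap: "distr lebesgue lebesgue prod.swap = (lebesgue :: (real \<times> real) measure)"
proof -
  have swap: "prod.swap = (\<lambda>(x, y). (y, x) :: real \<times> real)" by auto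
  have m: "(prod.swap :: real \<times> real \<Rightarrow> _) \<in> lborel \<rightarrow>\<^sub>M lborel"
    unfolding prod.swap_def measurable_lborel1 measurable_lborel2
    by (intro borel_measurable_continuous_onI continuous_intros)
  have d: "distr lebesgue lborel prod.swap = (lborel :: (real \<times> real) measure)"
    using lborel_pair.distr_pair_swap[symmetric] m unfolding swap lborel_prod
    by (subst distr_completion) simp_all
  interpret completion: complete_measure "lebesgue :: (real \<times> real) measure" ..
  show "(prod.swap :: real \<times> real \<Rightarrow> _) \<in> lebesgue \<rightarrow>\<^sub>M lebesgue"
    by (rule completion.measurable_completion2[OF measurable_completion[OF m]]) (simp add: d)
  show "distr lebesgue lebesgue prod.swap = (lebesgue :: (real \<times> real) measure)"
    using completion.completion_distr_eq[OF measurable_completion[OF m]] by (simp add: d)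
qed

text \<open>
  The exchange of coordinates is its own inverse, so $f$ is measurable before it if and only if it
  is so afterwards; without measurability both integrals are 0 by convention.
\<close>

lemma integral_lebesgue_swap:
  fixes f :: "real \<times> real \<Rightarrow> real"
  shows "(\<integral>p. f (prod.swap p) \<partial>lebesgue) = integral\<^sup>L lebesgue f"
proof -
  note sw = measurable_lebesgue_swap
  show ?thesis
  proof (cases "f \<in> borel_measurable lebesgue")
    case True
    have "integral\<^sup>L lebesgue f = integral\<^sup>L (distr lebesgue lebesgue prod.swap) f"
      by (simp add: distr_lebesgue_swap)
    also have "\<dots> = (\<integral>p. f (prod.swap p) \<partial>lebesgue)"
      by (rule integral_distr[OF sw True])
    finally show ?thesis by simp
  next
    case False
    have "(\<lambda>p. f (prod.swap p)) \<notin> borel_measurable lebesgue"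
    proof
      assume "(\<lambda>p. f (prod.swap p)) \<in> borel_measurable lebesgue"
      from measurable_compose[OF sw this] show False using False by simp
    qed
    with False show ?thesis
      by (metis borel_measurable_integrable not_integrable_integral_eq)
  qed
qed

lemma mem_swap_image: "p \<in> prod.swap ` S \<longleftrightarrow> prod.swap p \<in> S"
  by (cases p) force

lemma L1_norm_partial_y_swap:
  "L1_norm \<Omega> (partial_y u) = L1_norm (prod.swap ` \<Omega>) (partial_x (u \<circ> prod.swap))"
proof -
  have *: "indicator (prod.swap ` \<Omega>) p = (indicator \<Omega> (prod.swap p) :: real)" for p :: "real \<times> real"
    by (simp add: indicator_def mem_swap_image)
  have "partial_x (u \<circ> prod.swap) p = partial_y u (prod.swap p)" for p
    by (simp add: partial_x_def partial_y_def)
  then show ?thesis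
    using integral_lebesgue_swap[of "\<lambda>p. indicator \<Omega> p * \<bar>partial_y u p\<bar>"]
    by (simp add: L1_norm_def set_lebesgue_integral_def *)
qed

lemma linear_swap: "linear (prod.swap :: real \<times> real \<Rightarrow> real \<times> real)"
  by (rule linearI) auto

lemma interior_swap: "interior (prod.swap ` S) = prod.swap ` interior (S :: (real \<times> real) set)"
  by (intro interior_injective_linear_image linear_swap) (auto simp: inj_def)

lemma concave_bump_swap:
  assumes "concave_bump \<Omega> v"
  shows "concave_bump (prod.swap ` \<Omega>) (v \<circ> prod.swap)"
proof -
  interpret concave_bump \<Omega> v by fact
  show ?thesis
  proof
    show "convex_compact_domain (prod.swap ` \<Omega>)"
      using interior_nonempty
      by (simp add: convex_compact_domain_def interior_swap convex_linear_image[OF linear_swap convex_domain]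
          compact_continuous_image[OF continuous_on_swap compact_domain])
    show "continuous_on UNIV (v \<circ> prod.swap)"
      by (intro continuous_on_compose continuous_on_swap continuous_on_subset[OF continuous]) auto
    show "concave_on (prod.swap ` \<Omega>) (v \<circ> prod.swap)"
      unfolding concave_on_iff
    proof (intro conjI ballI allI impI)
      show "convex (prod.swap ` \<Omega>)" by (rule convex_linear_image[OF linear_swap convex_domain])
      fix p q s t assume "p \<in> prod.swap ` \<Omega>" "q \<in> prod.swap ` \<Omega>" "0 \<le> s" "0 \<le> t" "s + t = (1 :: real)"
      then show "s * (v \<circ> prod.swap) p + t * (v \<circ> prod.swap) q \<le> (v \<circ> prod.swap) (s *\<^sub>R p + t *\<^sub>R q)"
        using concaveD[of "prod.swap p" "prod.swap q" s t] by auto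
    qed
    show "(v \<circ> prod.swap) p = 0" if "p \<notin> interior (prod.swap ` \<Omega>)" for p
      using that by (auto intro!: zero_outside simp: interior_swap mem_swap_image)
  qed
qed

definition zero_extension :: "(real \<times> real) set \<Rightarrow> (real \<times> real \<Rightarrow> real) \<Rightarrow> real \<times> real \<Rightarrow> real" where
  "zero_extension \<Omega> u p = (if p \<in> \<Omega> then u p else 0)"

lemma concave_bump_zero_extension:
  assumes "convex_compact_domain \<Omega>" "u \<in> U_class \<Omega>"
  shows "concave_bump \<Omega> (zero_extension \<Omega> u)"
proof
  have cl: "closed \<Omega>" using assms(1) by (simp add: convex_compact_domain_def compact_imp_closed)
  have u: "continuous_on \<Omega> u" "concave_on \<Omega> u" "\<And>p. p \<in> frontier \<Omega> \<Longrightarrow> u p = 0"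
    using assms(2) by (auto simp: U_class_def)
  have "continuous_on (\<Omega> \<union> closure (- \<Omega>)) (\<lambda>p. if p \<in> \<Omega> then u p else 0)"
    using u cl by (intro continuous_on_cases) (auto simp: frontier_closures)
  moreover have "\<Omega> \<union> closure (- \<Omega>) = UNIV" using closure_subset[of "- \<Omega>"] by auto
  ultimately show "continuous_on UNIV (zero_extension \<Omega> u)"
    by (simp add: zero_extension_def[abs_def])
  have "convex \<Omega>" using assms(1) by (simp add: convex_compact_domain_def)
  then show "concave_on \<Omega> (zero_extension \<Omega> u)"
    using u(2) by (auto simp: concave_on_iff zero_extension_def convexD)
  show "zero_extension \<Omega> u p = 0" if "p \<notin> interior \<Omega>" for p
    using that u(3) cl by (auto simp: zero_extension_def frontier_def)
qed (fact assms(1))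

text \<open>
  The quotient to be estimated is thereby expressed through the two silhouettes of the graph
  of $u$, seen along the $x$-axis and along the $y$-axis.
\<close>

lemma L1_norms_eq_ridge_integrals:
  assumes "convex_compact_domain \<Omega>" "u \<in> U_class \<Omega>"
  shows "L1_norm \<Omega> (partial_x u) = 2 * integral\<^sup>L lborel (ridge (zero_extension \<Omega> u))"
    and "L1_norm \<Omega> (partial_y u) = 2 * integral\<^sup>L lborel (ridge (zero_extension \<Omega> u \<circ> prod.swap))"
proof -
  note b = concave_bump_zero_extension[OF assms]
  have eq: "u p = zero_extension \<Omega> u p" if "p \<in> interior \<Omega>" for p
    using that interior_subset[of \<Omega>] by (auto simp: zero_extension_def)
  show "L1_norm \<Omega> (partial_x u) = 2 * integral\<^sup>L lborel (ridge (zero_extension \<Omega> u))"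
    by (rule concave_bump.L1_norm_partial_x_eq[OF b eq])
  show "L1_norm \<Omega> (partial_y u) = 2 * integral\<^sup>L lborel (ridge (zero_extension \<Omega> u \<circ> prod.swap))"
    unfolding L1_norm_partial_y_swap
    by (rule concave_bump.L1_norm_partial_x_eq[OF concave_bump_swap[OF b]])
      (auto simp: interior_swap eq)
qed

section \<open>Integrals of concave functions on an interval\<close>

lemma has_integral_affine:
  fixes p k s t :: real
  assumes "s \<le> t"
  shows "((\<lambda>x. p + (x - s) * k) has_integral (p * (t - s) + (t - s)\<^sup>2 * k / 2)) {s..t}"
proof -
  have "((\<lambda>x. p + (x - s) * k) has_integral
      ((p * t + (t - s)\<^sup>2 * k / 2) - (p * s + (s - s)\<^sup>2 * k / 2))) {s..t}"
    by (intro fundamental_theorem_of_calculus assms)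
      (auto intro!: derivative_eq_intros simp: has_real_derivative_iff_has_vector_derivative[symmetric])
  then show ?thesis by (simp add: algebra_simps)
qed

lemma concave_trapezoid_le_integral:
  fixes g :: "real \<Rightarrow> real"
  assumes "concave_on {s..t} g" "g integrable_on {s..t}" "s \<le> t"
  shows "(t - s) * (g s + g t) / 2 \<le> integral {s..t} g"
proof (cases "s = t")
  case False
  with assms(3) have st: "s < t" by simp
  define k where "k = (g t - g s) / (t - s)"
  have "(t - s) * k = g t - g s" using st by (simp add: k_def)
  then have "(t - s)\<^sup>2 * k = (t - s) * (g t - g s)" by (simp add: power2_eq_square)
  then have eq: "g s * (t - s) + (t - s)\<^sup>2 * k / 2 = (t - s) * (g s + g t) / 2"
    by (simp add: field_simps)
  have c: "((\<lambda>x. g s + (x - s) * k) has_integral (t - s) * (g s + g t) / 2) {s..t}"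
    using has_integral_affine[OF assms(3), of "g s" k] unfolding eq .
  have "g s + (x - s) * k \<le> g x" if "x \<in> {s..t}" for x
    using concave_onD_Icc'[OF assms(1) that] by (simp add: k_def algebra_simps)
  then show ?thesis
    by (intro has_integral_le[OF c integrable_integral[OF assms(2)]])
qed simp

lemma concave_on_min_le:
  fixes f :: "real \<Rightarrow> real"
  assumes "concave_on S f" "x \<in> S" "z \<in> S" "x \<le> y" "y \<le> z"
  shows "min (f x) (f z) \<le> f y"
proof -
  have "y \<in> closed_segment x z" using assms(4,5) by (simp add: closed_segment_eq_real_ivl)
  then obtain u where u: "0 \<le> u" "u \<le> 1" "y = (1 - u) *\<^sub>R x + u *\<^sub>R z"
    by (auto simp: closed_segment_def)
  have "min (f x) (f z) = (1 - u) * min (f x) (f z) + u * min (f x) (f z)" by (simp add: algebra_simps)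
  also have "\<dots> \<le> (1 - u) * f x + u * f z"
    using u by (intro add_mono mult_left_mono) auto
  also have "\<dots> \<le> f y"
    using assms(1-3) u unfolding concave_on_iff by auto
  finally show ?thesis .
qed

text \<open>
  Both silhouettes of a bump are such functions.
\<close>

locale concave_profile =
  fixes a b :: real and g :: "real \<Rightarrow> real"
  assumes concave_profile: "concave_on {a..b} g"
    and profile_nonneg: "0 \<le> g x"
    and profile_zero: "x \<notin> {a..b} \<Longrightarrow> g x = 0"
    and profile_integrable: "integrable lborel g"
begin

lemma has_integral_profile: "(g has_integral integral\<^sup>L lborel g) {a..b}"
proof -
  have "(g has_integral integral\<^sup>L lborel g) UNIV"
    by (rule has_integral_integral_lborel[OF profile_integrable])
  moreover have "(\<lambda>x. if x \<in> {a..b} then g x else 0) = g" using profile_zero by auto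
  ultimately show ?thesis using has_integral_restrict_UNIV[of "{a..b}" g] by simp
qed

text \<open>
  The trapezoid with base $[a,b]$ and upper side of height $k$ over $[s,t]$ fits under the graph.
  For $s = t$ it is a triangle; otherwise there is a gain proportional to $t - s$.
\<close>

lemma two_point_lower_bound:
  assumes k: "k \<le> g s" "k \<le> g t" "0 \<le> k" and st: "a \<le> s" "s \<le> t" "t \<le> b"
  shows "k * (b - a + (t - s)) / 2 \<le> integral\<^sup>L lborel g"
proof -
  have int: "g integrable_on {a..b}" using has_integral_profile by blast
  have sub: "g integrable_on {x..y}" "concave_on {x..y} g" if "a \<le> x" "y \<le> b" for x y
    using that concave_profile unfolding concave_on_def
    by (auto intro!: integrable_subinterval_real[OF int] elim: convex_on_subset)
  have "integral\<^sup>L lborel g = integral {a..b} g" using has_integral_profile by (simp add: integral_unique)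
  also have "\<dots> = integral {a..s} g + integral {s..t} g + integral {t..b} g"
    using st int sub Henstock_Kurzweil_Integration.integral_combine[of a s b g]
      Henstock_Kurzweil_Integration.integral_combine[of s t b g] by auto
  finally have eq: "integral\<^sup>L lborel g = integral {a..s} g + integral {s..t} g + integral {t..b} g" .
  have "(s - a) * k / 2 \<le> (s - a) * (g a + g s) / 2"
    using k st profile_nonneg[of a] by (intro divide_right_mono mult_left_mono) auto
  moreover have "(s - a) * (g a + g s) / 2 \<le> integral {a..s} g"
    using st by (intro concave_trapezoid_le_integral sub) auto
  moreover have "(t - s) * (2 * k) / 2 \<le> (t - s) * (g s + g t) / 2"
    using k st by (intro divide_right_mono mult_left_mono) auto
  moreover have "(t - s) * (g s + g t) / 2 \<le> integral {s..t} g"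
    using st by (intro concave_trapezoid_le_integral sub) auto
  moreover have "(b - t) * k / 2 \<le> (b - t) * (g t + g b) / 2"
    using k st profile_nonneg[of b] by (intro divide_right_mono mult_left_mono) auto
  moreover have "(b - t) * (g t + g b) / 2 \<le> integral {t..b} g"
    using st by (intro concave_trapezoid_le_integral sub) auto
  moreover have "k * (b - a + (t - s)) / 2 = (s - a) * k / 2 + (t - s) * (2 * k) / 2 + (b - t) * k / 2"
    by (simp add: field_simps)
  ultimately show ?thesis unfolding eq by linarith
qed

lemma integral_upper_bound_gap:
  assumes "\<And>x. g x \<le> m" "\<And>x. x \<in> {s..t} \<Longrightarrow> g x \<le> m - k" "a \<le> s" "s \<le> t" "t \<le> b"
  shows "integral\<^sup>L lborel g \<le> m * (b - a) - k * (t - s)"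
proof -
  have i: "integrable lborel (\<lambda>x. m * indicator {a..b} x - k * indicator {s..t} x :: real)"
    by (intro Bochner_Integration.integrable_diff integrable_mult_right integrable_real_indicator) (simp_all add: emeasure_compact_finite[unfolded infinity_ennreal_def])
  have "integral\<^sup>L lborel g \<le> (\<integral>x. m * indicator {a..b} x - k * indicator {s..t} x \<partial>lborel)"
    using assms profile_zero
    by (intro integral_mono profile_integrable i) (auto simp: indicator_def)
  also have "\<dots> = m * (b - a) - k * (t - s)"
    using assms(3-5)
    by (subst Bochner_Integration.integral_diff)
      (auto intro!: integrable_mult_right integrable_real_indicator emeasure_compact_finite[unfolded infinity_ennreal_def])
  finally show ?thesis .
qed

text \<open>
  The tent over $[a,b]$ with height 1 has the area $(b-a)/2$ wherever its apex $z$ is.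
\<close>

lemma tent_upper_bound:
  assumes z: "a < z" "z < b"
    and left: "\<And>x. x \<in> {a..b} \<Longrightarrow> g x \<le> (x - a) / (z - a)"
    and right: "\<And>x. x \<in> {a..b} \<Longrightarrow> g x \<le> (b - x) / (b - z)"
  shows "integral\<^sup>L lborel g \<le> (b - a) / 2"
proof -
  have l: "((\<lambda>x. (x - a) / (z - a)) has_integral (z - a) / 2) {a..z}"
    using has_integral_affine[of a z 0 "1 / (z - a)"] z by (simp add: power2_eq_square)
  have eq1: "1 + (x - z) * (- 1 / (b - z)) = (b - x) / (b - z)" for x
    using z by (simp add: field_simps)
  have eq2: "1 * (b - z) + (b - z)\<^sup>2 * (- 1 / (b - z)) / 2 = (b - z) / 2"
    using z by (simp add: power2_eq_square field_simps)
  have r: "((\<lambda>x. (b - x) / (b - z)) has_integral (b - z) / 2) {z..b}"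
    using has_integral_affine[OF less_imp_le[OF z(2)], of 1 "- 1 / (b - z)"] unfolding eq1 eq2 .
  have int: "g integrable_on {a..b}" using has_integral_profile by blast
  have sub: "g integrable_on {x..y}" if "a \<le> x" "y \<le> b" for x y
    using that by (auto intro!: integrable_subinterval_real[OF int])
  have "integral {a..z} g \<le> (z - a) / 2"
    using z left by (intro has_integral_le[OF integrable_integral l] sub) auto
  moreover have "integral {z..b} g \<le> (b - z) / 2"
    using z right by (intro has_integral_le[OF integrable_integral r] sub) auto
  moreover have "integral\<^sup>L lborel g = integral {a..z} g + integral {z..b} g"
    using z int has_integral_profile Henstock_Kurzweil_Integration.integral_combine[of a z b g]
    by (simp add: integral_unique)
  ultimately show ?thesis by (simp add: field_simps)
qed

end

section \<open>Upper bounds for the quotient\<close>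

lemma (in concave_bump) concave_profile_ridge:
  assumes "snd ` \<Omega> = {c..d}"
  shows "concave_profile c d (ridge v)"
  using concave_ridge ridge_nonneg ridge_zero_outside integrable_ridge assms
  by unfold_locales auto

lemma ridge_swap_ge:
  assumes "concave_bump \<Omega> v"
  shows "v (x, y) \<le> ridge (v \<circ> prod.swap) x"
  using concave_bump.le_ridge[OF concave_bump_swap[OF assms], of y x] by simp

lemma concave_profile_ridge_swap:
  assumes "concave_bump \<Omega> v" "fst ` \<Omega> = {a..b}"
  shows "concave_profile a b (ridge (v \<circ> prod.swap))"
  using assms(2)
  by (intro concave_bump.concave_profile_ridge[OF concave_bump_swap[OF assms(1)]]) (simp add: image_image)

text \<open>
  Let $m$ be the maximum of $v$. The maxima over horizontal lines stay below a rectangle of height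
  $m$, while those over vertical lines form a concave function with maximum $m$, whose graph lies
  above a triangle of that height. Dividing gives the constant $2(d-c)/(b-a)$.
\<close>

lemma ridge_integral_ratio_bounds:
  assumes v: "concave_bump \<Omega> v" and ab: "fst ` \<Omega> = {a..b}" and cd: "snd ` \<Omega> = {c..d}"
    and nz: "v p\<^sub>0 \<noteq> 0"
  obtains m where "m > 0" "\<And>p. v p \<le> m"
    "integral\<^sup>L lborel (ridge v) \<le> m * (d - c)"
    "m * (b - a) / 2 \<le> integral\<^sup>L lborel (ridge (v \<circ> prod.swap))"
proof -
  interpret concave_bump \<Omega> v by fact
  interpret M: concave_profile c d "ridge v" by (rule concave_profile_ridge[OF cd])
  interpret N: concave_profile a b "ridge (v \<circ> prod.swap)" by (rule concave_profile_ridge_swap[OF v ab])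
  have p0: "p\<^sub>0 \<in> \<Omega>" using nz zero_outside_domain by blast
  obtain p where p: "p \<in> \<Omega>" "\<And>q. q \<in> \<Omega> \<Longrightarrow> v q \<le> v p"
    using continuous_attains_sup[OF compact_domain _ continuous_on_subset[OF continuous subset_UNIV]] p0
    by blast
  have le: "v q \<le> v p" for q
    using p(2)[of q] zero_outside_domain[of q] nonneg[of p] by (cases "q \<in> \<Omega>") auto
  have pos: "0 < v p" using le[of p\<^sub>0] nonneg[of p\<^sub>0] nz by linarith
  have fp: "fst p \<in> {a..b}" "snd p \<in> {c..d}" using p(1) ab cd by (metis imageI)+
  have "ridge v y \<le> v p" for y using le pos by (intro ridge_leI) auto
  then have "integral\<^sup>L lborel (ridge v) \<le> v p * (d - c) - 0 * (c - c)"
    using fp(2) by (intro M.integral_upper_bound_gap) auto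
  moreover have "v p * (b - a + (fst p - fst p)) / 2 \<le> integral\<^sup>L lborel (ridge (v \<circ> prod.swap))"
    using fp ridge_swap_ge[OF v, of "fst p" "snd p"] pos
    by (intro N.two_point_lower_bound) auto
  ultimately show ?thesis using that[of "v p"] le pos by auto
qed

text \<open>
  The supremum need not be attained, so strictness requires a bound that is uniform in $v$. Near
  equality in the rectangle estimate forces \<open>ridge v\<close> to be high near $c$ and near $d$; near equality
  in the triangle estimate forces all high points to have nearly the same abscissa. Together these
  would produce points of $\<Omega>$ near the two ends of a full vertical segment, which $\<delta>$ excludes.
  Hence one of the two estimates improves by a fixed amount: if \<open>ridge v\<close> is at least $(1-\<kappa>)m$ at
  $c+\<epsilon>$ and at $d-\<epsilon>$, the triangle becomes a trapezoid; if not, by concavity it stays below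
  $(1-\<kappa>)m$ on a whole interval of length at least $\<epsilon>$.
\<close>

lemma no_full_segment_ratio_gap:
  fixes \<Omega> :: "(real \<times> real) set"
  assumes ab: "fst ` \<Omega> = {a..b}" "a < b" and cd: "snd ` \<Omega> = {c..d}" "c < d"
    and \<delta>: "\<delta> > 0" "\<And>p q. p \<in> \<Omega> \<Longrightarrow> q \<in> \<Omega> \<Longrightarrow> \<delta> \<le> (snd p - c) + (d - snd q) + \<bar>fst p - fst q\<bar>"
  obtains C where "C < 2 * ((d - c) / (b - a))"
    "\<And>v p. concave_bump \<Omega> v \<Longrightarrow> v p \<noteq> 0 \<Longrightarrow>
      integral\<^sup>L lborel (ridge v) \<le> C * integral\<^sup>L lborel (ridge (v \<circ> prod.swap))"
proof -
  \<comment> \<open>With this $\<epsilon>$, points of $\<Omega>$ with ordinates $c+\<epsilon>$ and $d-\<epsilon>$ are at horizontal distance at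
    least $\<delta>/2$, which is the gain of the trapezoid; lowering it by the factor $1-\<kappa>$ costs half of
    that gain.\<close>
  define \<epsilon> where "\<epsilon> = \<delta> / 4"
  define \<kappa> where "\<kappa> = (\<delta> / 4) / (b - a + \<delta> / 2)"
  have pos: "0 < b - a + \<delta> / 2" "0 < b - a + \<delta> / 4" "\<epsilon> > 0" using \<delta>(1) ab(2) by (auto simp: \<epsilon>_def)
  have \<kappa>: "0 < \<kappa>" "\<kappa> < 1" "(1 - \<kappa>) * (b - a + \<delta> / 2) = b - a + \<delta> / 4"
    using pos \<delta>(1) ab(2) by (auto simp: \<kappa>_def field_simps)
  obtain p where "p \<in> \<Omega>" using ab by fastforce
  then have "\<delta> \<le> d - c" using \<delta>(2)[of p p] by simp
  then have \<epsilon>: "4 * \<epsilon> \<le> d - c" by (simp add: \<epsilon>_def)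
  define C\<^sub>1 where "C\<^sub>1 = 2 * (d - c) / (b - a + \<delta> / 4)"
  define C\<^sub>2 where "C\<^sub>2 = 2 * (d - c - \<kappa> * \<epsilon>) / (b - a)"
  have C0: "0 < C\<^sub>1" using cd pos by (simp add: C\<^sub>1_def)
  show ?thesis
  proof (rule that[of "max C\<^sub>1 C\<^sub>2"])
    have "C\<^sub>1 < 2 * (d - c) / (b - a)"
      unfolding C\<^sub>1_def using cd(2) ab(2) \<delta>(1) by (intro divide_strict_left_mono) auto
    moreover have "C\<^sub>2 < 2 * (d - c) / (b - a)"
      unfolding C\<^sub>2_def using ab(2) \<kappa>(1) pos(3) by (intro divide_strict_right_mono) auto
    ultimately show "max C\<^sub>1 C\<^sub>2 < 2 * ((d - c) / (b - a))" by simp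
  next
    fix v p assume v: "concave_bump \<Omega> v" and nz: "v p \<noteq> 0"
    let ?I = "integral\<^sup>L lborel (ridge v)" and ?J = "integral\<^sup>L lborel (ridge (v \<circ> prod.swap))"
    interpret concave_bump \<Omega> v by fact
    interpret M: concave_profile c d "ridge v" by (rule concave_profile_ridge[OF cd(1)])
    interpret N: concave_profile a b "ridge (v \<circ> prod.swap)"
      by (rule concave_profile_ridge_swap[OF v ab(1)])
    obtain m where m: "m > 0" "\<And>p. v p \<le> m" "?I \<le> m * (d - c)" "m * (b - a) / 2 \<le> ?J"
      using ridge_integral_ratio_bounds[OF v ab(1) cd(1) nz] by metis
    have J: "0 \<le> ?J" using m(1,4) ab(2) by (smt (verit) divide_nonneg_nonneg mult_nonneg_nonneg)
    have "?I \<le> C\<^sub>1 * ?J \<or> ?I \<le> C\<^sub>2 * ?J"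
    proof (cases "(1 - \<kappa>) * m \<le> ridge v (c + \<epsilon>) \<and> (1 - \<kappa>) * m \<le> ridge v (d - \<epsilon>)")
      case True
      have "c + \<epsilon> \<in> snd ` \<Omega>" "d - \<epsilon> \<in> snd ` \<Omega>" using cd \<epsilon> pos by auto
      then obtain x\<^sub>1 x\<^sub>2 where x: "(x\<^sub>1, c + \<epsilon>) \<in> \<Omega>" "ridge v (c + \<epsilon>) = v (x\<^sub>1, c + \<epsilon>)"
          "(x\<^sub>2, d - \<epsilon>) \<in> \<Omega>" "ridge v (d - \<epsilon>) = v (x\<^sub>2, d - \<epsilon>)"
        using ridge_attained by metis
      have in_ab: "x\<^sub>1 \<in> {a..b}" "x\<^sub>2 \<in> {a..b}" using x ab(1) by force+
      have gap: "\<delta> / 2 \<le> \<bar>x\<^sub>1 - x\<^sub>2\<bar>" using \<delta>(2)[OF x(1,3)] by (simp add: \<epsilon>_def)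
      define s t where "s = min x\<^sub>1 x\<^sub>2" and "t = max x\<^sub>1 x\<^sub>2"
      have "(1 - \<kappa>) * m \<le> ridge (v \<circ> prod.swap) x\<^sub>1" "(1 - \<kappa>) * m \<le> ridge (v \<circ> prod.swap) x\<^sub>2"
        using True x ridge_swap_ge[OF v] order_trans by metis+
      then have "(1 - \<kappa>) * m \<le> ridge (v \<circ> prod.swap) s" "(1 - \<kappa>) * m \<le> ridge (v \<circ> prod.swap) t"
        unfolding s_def t_def by (simp_all add: min_def max_def)
      then have "(1 - \<kappa>) * m * (b - a + (t - s)) / 2 \<le> ?J"
        using in_ab m(1) \<kappa>(2) by (intro N.two_point_lower_bound) (auto simp: s_def t_def)
      moreover have "(1 - \<kappa>) * m * (b - a + \<delta> / 2) / 2 \<le> (1 - \<kappa>) * m * (b - a + (t - s)) / 2"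
        using gap m(1) \<kappa>(2) by (intro divide_right_mono mult_left_mono) (auto simp: s_def t_def max_def min_def)
      moreover have "(1 - \<kappa>) * m * (b - a + \<delta> / 2) = m * (b - a + \<delta> / 4)"
        using \<kappa>(3) by (metis mult.commute mult.left_commute)
      ultimately have "m * (b - a + \<delta> / 4) / 2 \<le> ?J" by simp
      then have "C\<^sub>1 * (m * (b - a + \<delta> / 4) / 2) \<le> C\<^sub>1 * ?J" using C0 by (intro mult_left_mono) auto
      moreover have "C\<^sub>1 * (m * (b - a + \<delta> / 4) / 2) = m * (d - c)"
        using pos(2) by (simp add: C\<^sub>1_def field_simps)
      ultimately have "?I \<le> C\<^sub>1 * ?J" using m(3) by linarith
      then show ?thesis ..
    next
      case False
      then obtain y\<^sub>0 where y0: "y\<^sub>0 = c + \<epsilon> \<or> y\<^sub>0 = d - \<epsilon>" "ridge v y\<^sub>0 < (1 - \<kappa>) * m"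
        by (metis not_le)
      then have y0': "c + \<epsilon> \<le> y\<^sub>0" "y\<^sub>0 \<le> d - \<epsilon>" using \<epsilon> pos(3) by auto
      have qc: "min (ridge v y\<^sub>1) (ridge v y\<^sub>2) \<le> ridge v y\<^sub>0"
        if "y\<^sub>1 \<in> {c..y\<^sub>0}" "y\<^sub>2 \<in> {y\<^sub>0..d}" for y\<^sub>1 y\<^sub>2
        using that y0' pos(3) by (intro concave_on_min_le[OF M.concave_profile]) auto
      have low: "(\<forall>y\<in>{c..y\<^sub>0}. ridge v y \<le> m - \<kappa> * m) \<or> (\<forall>y\<in>{y\<^sub>0..d}. ridge v y \<le> m - \<kappa> * m)"
      proof (rule ccontr)
        assume "\<not> ?thesis"
        then obtain y\<^sub>1 y\<^sub>2 where "y\<^sub>1 \<in> {c..y\<^sub>0}" "y\<^sub>2 \<in> {y\<^sub>0..d}" "m - \<kappa> * m < ridge v y\<^sub>1" "m - \<kappa> * m < ridge v y\<^sub>2"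
          by (auto simp: not_le)
        then show False using qc[of y\<^sub>1 y\<^sub>2] y0(2) by (simp add: algebra_simps)
      qed
      have top: "ridge v y \<le> m" for y using m(1,2) by (intro ridge_leI) auto
      have "?I \<le> m * (d - c) - \<kappa> * m * \<epsilon>"
        using low
      proof
        assume *: "\<forall>y\<in>{c..y\<^sub>0}. ridge v y \<le> m - \<kappa> * m"
        have "?I \<le> m * (d - c) - \<kappa> * m * (y\<^sub>0 - c)"
          using * y0' pos(3) top by (intro M.integral_upper_bound_gap) auto
        also have "\<dots> \<le> m * (d - c) - \<kappa> * m * \<epsilon>"
          using y0' m(1) \<kappa>(1) by (intro diff_left_mono mult_left_mono) auto
        finally show ?thesis .
      next
        assume *: "\<forall>y\<in>{y\<^sub>0..d}. ridge v y \<le> m - \<kappa> * m"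
        have "?I \<le> m * (d - c) - \<kappa> * m * (d - y\<^sub>0)"
          using * y0' pos(3) top by (intro M.integral_upper_bound_gap) auto
        also have "\<dots> \<le> m * (d - c) - \<kappa> * m * \<epsilon>"
          using y0' m(1) \<kappa>(1) by (intro diff_left_mono mult_left_mono) auto
        finally show ?thesis .
      qed
      also have "\<dots> = C\<^sub>2 * (m * (b - a) / 2)"
        using ab(2) by (simp add: C\<^sub>2_def field_simps)
      also have "\<dots> \<le> C\<^sub>2 * ?J"
      proof (rule mult_left_mono[OF m(4)])
        have "\<kappa> * \<epsilon> \<le> 1 * \<epsilon>" using \<kappa> pos by (intro mult_right_mono) auto
        also have "\<dots> \<le> d - c" using \<epsilon> pos(3) by simp
        finally have "\<kappa> * \<epsilon> \<le> d - c" .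
        then show "0 \<le> C\<^sub>2" using ab(2) by (simp add: C\<^sub>2_def)
      qed
      finally show ?thesis ..
    qed
    then show "?I \<le> max C\<^sub>1 C\<^sub>2 * ?J"
      using J by (smt (verit) mult_right_mono)
  qed
qed

section \<open>Nearly extremal functions\<close>

lemma concave_on_min:
  assumes "concave_on S f" "concave_on S g"
  shows "concave_on S (\<lambda>x. min (f x) (g x))"
  unfolding concave_on_iff
proof (intro conjI ballI allI impI)
  show "convex S" using assms(1) by (simp add: concave_on_iff)
  fix x y and s t :: real
  assume *: "x \<in> S" "y \<in> S" "0 \<le> s" "0 \<le> t" "s + t = 1"
  have "s * min (f x) (g x) + t * min (f y) (g y) \<le> s * f x + t * f y"
    "s * min (f x) (g x) + t * min (f y) (g y) \<le> s * g x + t * g y"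
    using * by (auto intro!: add_mono mult_left_mono)
  moreover have "s * f x + t * f y \<le> f (s *\<^sub>R x + t *\<^sub>R y)" "s * g x + t * g y \<le> g (s *\<^sub>R x + t *\<^sub>R y)"
    using assms * by (auto simp: concave_on_iff)
  ultimately show "s * min (f x) (g x) + t * min (f y) (g y)
      \<le> min (f (s *\<^sub>R x + t *\<^sub>R y)) (g (s *\<^sub>R x + t *\<^sub>R y))"
    by linarith
qed

lemma concave_on_affine_fst:
  fixes S :: "(real \<times> real) set"
  assumes "convex S"
  shows "concave_on S (\<lambda>r. l + fst r * k)"
  unfolding concave_on_iff
proof (intro conjI ballI allI impI assms)
  fix p q :: "real \<times> real" and s t :: real
  assume "s + t = 1"
  then have "l = s * l + t * l" by (metis distrib_right mult_1)
  then show "s * (l + fst p * k) + t * (l + fst q * k) \<le> l + fst (s *\<^sub>R p + t *\<^sub>R q) * k"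
    by (simp add: algebra_simps)
qed

lemma ball_infdist_complement: "ball p (infdist p (- S)) \<subseteq> S"
proof
  fix q assume "q \<in> ball p (infdist p (- S))"
  then show "q \<in> S" using infdist_le[of q "- S" p] by auto
qed

text \<open>
  Discs around $p$ and $q$ contained in the convex set $S$ have in their convex hull a disc around
  each intermediate point whose radius is the corresponding weighted mean.
\<close>

lemma concave_on_infdist_complement:
  fixes S :: "'a :: euclidean_space set"
  assumes S: "convex S" and ne: "- S \<noteq> {}"
  shows "concave_on S (\<lambda>p. infdist p (- S))"
  unfolding concave_on_iff
proof (intro conjI ballI allI impI S)
  fix p q and s t :: real
  assume pq: "p \<in> S" "q \<in> S" and st: "0 \<le> s" "0 \<le> t" "s + t = 1"
  define d e where "d = infdist p (- S)" and "e = infdist q (- S)"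
  have de: "0 \<le> d" "0 \<le> e" by (simp_all add: d_def e_def infdist_nonneg)
  have "s * d + t * e \<le> dist (s *\<^sub>R p + t *\<^sub>R q) w" if w: "w \<in> - S" for w
  proof (rule ccontr)
    define r where "r = s * d + t * e"
    define h where "h = (1 / r) *\<^sub>R (w - (s *\<^sub>R p + t *\<^sub>R q))"
    assume "\<not> ?thesis"
    then have lt: "norm (w - (s *\<^sub>R p + t *\<^sub>R q)) < r" by (simp add: r_def dist_norm norm_minus_commute)
    then have r: "r > 0" using norm_ge_zero le_less_trans by blast
    then have h: "norm h < 1" using lt by (simp add: h_def)
    have in_S: "x + c *\<^sub>R h \<in> S" if "x \<in> S" "c = infdist x (- S)" for x c
    proof (cases "c = 0")
      case False
      then have "c > 0" using that infdist_nonneg[of x "- S"] by simp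
      then have "norm (c *\<^sub>R h) < c" using h by simp
      then have "x + c *\<^sub>R h \<in> ball x c" by (simp add: dist_norm)
      then show ?thesis using ball_infdist_complement[of x S] that by auto
    qed (use that in simp)
    have "s *\<^sub>R (p + d *\<^sub>R h) + t *\<^sub>R (q + e *\<^sub>R h) \<in> S"
      using in_S pq st by (intro convexD[OF S]) (auto simp: d_def e_def)
    also have "s *\<^sub>R (p + d *\<^sub>R h) + t *\<^sub>R (q + e *\<^sub>R h) = s *\<^sub>R p + t *\<^sub>R q + r *\<^sub>R h"
      by (simp add: r_def algebra_simps)
    also have "\<dots> = w" using r by (simp add: h_def)
    finally show False using w by simp
  qed
  then have "s * d + t * e \<le> infdist (s *\<^sub>R p + t *\<^sub>R q) (- S)"
    unfolding infdist_notempty[OF ne] by (intro cINF_greatest ne)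
  then show "s * infdist p (- S) + t * infdist q (- S) \<le> infdist (s *\<^sub>R p + t *\<^sub>R q) (- S)"
    by (simp add: d_def e_def)
qed

lemma abs_deriv_le_of_lipschitz:
  fixes f :: "real \<Rightarrow> real"
  assumes "f field_differentiable (at x)" "\<And>t. \<bar>f t - f x\<bar> \<le> K * \<bar>t - x\<bar>"
  shows "\<bar>deriv f x\<bar> \<le> K"
proof -
  have "((\<lambda>h. (f (x + h) - f x) / h) \<longlongrightarrow> deriv f x) (at 0)"
    using assms(1) by (simp add: field_differentiable_derivI DERIV_def[symmetric])
  then have "((\<lambda>h. \<bar>(f (x + h) - f x) / h\<bar>) \<longlongrightarrow> \<bar>deriv f x\<bar>) (at 0)" by (rule tendsto_rabs)
  moreover have "\<forall>\<^sub>F h in at 0. \<bar>(f (x + h) - f x) / h\<bar> \<le> K"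
  proof -
    have "\<bar>(f (x + h) - f x) / h\<bar> \<le> K" if "h \<noteq> 0" for h
      using assms(2)[of "x + h"] that by (simp add: abs_divide divide_le_eq)
    then show ?thesis by (auto simp: eventually_at intro: exI[of _ 1])
  qed
  ultimately show ?thesis by (rule tendsto_upperbound) simp
qed

lemma lipschitz_bounded_gradient:
  assumes lip: "\<And>p q. \<bar>u p - u q\<bar> \<le> K * dist p q" and "gradient_exists u p"
  shows "norm (partial_x u p, partial_y u p) \<le> 2 * K"
proof -
  have "\<bar>u (t, snd p) - u (fst p, snd p)\<bar> \<le> K * \<bar>t - fst p\<bar>"
    "\<bar>u (fst p, t) - u (fst p, snd p)\<bar> \<le> K * \<bar>t - snd p\<bar>" for t
    using lip[of "(t, snd p)" "(fst p, snd p)"] lip[of "(fst p, t)" "(fst p, snd p)"]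
    unfolding dist_Pair_Pair by (simp_all add: dist_real_def)
  then have "\<bar>partial_x u p\<bar> \<le> K" "\<bar>partial_y u p\<bar> \<le> K"
    using assms(2) unfolding partial_x_def partial_y_def gradient_exists_def
    by (blast intro: abs_deriv_le_of_lipschitz)+
  then show ?thesis
    using norm_Pair_le[of "partial_x u p" "partial_y u p"] by simp
qed

lemma subset_cbox_projections:
  fixes \<Omega> :: "(real \<times> real) set"
  assumes "fst ` \<Omega> = {a..b}" "snd ` \<Omega> = {c..d}"
  shows "\<Omega> \<subseteq> cbox (a, c) (b, d)"
proof
  fix p assume "p \<in> \<Omega>"
  then have "fst p \<in> {a..b}" "snd p \<in> {c..d}" using assms by (metis imageI)+
  then show "p \<in> cbox (a, c) (b, d)" by (cases p) (simp add: cbox_Pair_eq)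
qed

lemma interior_subset_open_box:
  fixes \<Omega> :: "(real \<times> real) set"
  assumes "fst ` \<Omega> = {a..b}" "snd ` \<Omega> = {c..d}" "p \<in> interior \<Omega>"
  shows "a < fst p" "fst p < b" "c < snd p" "snd p < d"
proof -
  have "interior \<Omega> \<subseteq> box (a, c) (b, d)"
    using interior_mono[OF subset_cbox_projections[OF assms(1,2)]] by (simp add: interior_cbox)
  then have "p \<in> box (a, c) (b, d)" using assms(3) by blast
  then show "a < fst p" "fst p < b" "c < snd p" "snd p < d"
    by (cases p; auto simp: mem_box Basis_prod_def)+
qed

text \<open>
  Both estimates become nearly sharp for the minimum of a tent in $x$ over $[a,b]$, which bounds the
  maxima over vertical lines by a triangle, and a large multiple of the distance to the complement of $\<Omega>$, which
  enforces the boundary condition and is harmless away from the frontier. The apex of the tent must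
  carry high points near both horizontal sides: shrinking the full vertical segment towards an
  interior point $z$ of $\<Omega>$ makes it interior, so that its abscissa $x_1$ lies strictly
  between $a$ and $b$ even if the original segment is a vertical side of the rectangle.
\<close>

lemma near_extremal_function:
  assumes dom: "convex_compact_domain \<Omega>" and ab: "fst ` \<Omega> = {a..b}" and cd: "snd ` \<Omega> = {c..d}"
    and seg: "(x\<^sub>0, c) \<in> \<Omega>" "(x\<^sub>0, d) \<in> \<Omega>" and \<epsilon>: "0 < \<epsilon>" "\<epsilon> < 1"
  obtains u p where "u \<in> U_class \<Omega>" "p \<in> \<Omega>" "u p \<noteq> 0"
    "(1 - \<epsilon>) * (d - c) \<le> integral\<^sup>L lborel (ridge (zero_extension \<Omega> u))"
    "integral\<^sup>L lborel (ridge (zero_extension \<Omega> u \<circ> prod.swap)) \<le> (b - a) / 2"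
proof -
  have conv: "convex \<Omega>" and comp: "compact \<Omega>" and "interior \<Omega> \<noteq> {}"
    using dom by (auto simp: convex_compact_domain_def)
  then obtain z where z: "z \<in> interior \<Omega>" by auto
  note box = interior_subset_open_box[OF ab cd]
  define x\<^sub>1 where "x\<^sub>1 = x\<^sub>0 - \<epsilon> * (x\<^sub>0 - fst z)"
  define p where "p = (x\<^sub>1, c - \<epsilon> * (c - snd z))"
  define q where "q = (x\<^sub>1, d - \<epsilon> * (d - snd z))"
  have p: "p \<in> interior \<Omega>"
    using mem_interior_convex_shrink[OF conv z seg(1), of \<epsilon>] \<epsilon>
    by (cases z) (simp add: p_def x\<^sub>1_def)
  have q: "q \<in> interior \<Omega>"
    using mem_interior_convex_shrink[OF conv z seg(2), of \<epsilon>] \<epsilon>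
    by (cases z) (simp add: q_def x\<^sub>1_def)
  have x1: "a < x\<^sub>1" "x\<^sub>1 < b" using box[OF p] by (auto simp: p_def)
  have ne: "- \<Omega> \<noteq> {}" using comp by (metis Compl_UNIV_eq double_complement not_compact_UNIV)
  have pos: "0 < infdist r (- \<Omega>)" if "r \<in> interior \<Omega>" for r
  proof -
    have "r \<notin> closure (- \<Omega>)" using that by (simp add: closure_complement)
    then show ?thesis
      using in_closure_iff_infdist_zero[OF ne] infdist_nonneg[of r "- \<Omega>"] by (metis less_eq_real_def)
  qed
  \<comment> \<open>This slope makes the tent the smaller of the two functions at $p$ and $q$.\<close>
  define n where "n = 1 / min (infdist p (- \<Omega>)) (infdist q (- \<Omega>))"
  have n: "0 < n" "1 \<le> n * infdist p (- \<Omega>)" "1 \<le> n * infdist q (- \<Omega>)"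
    using pos[OF p] pos[OF q] by (auto simp: n_def field_simps)
  define u where "u r = min (min ((fst r - a) / (x\<^sub>1 - a)) ((b - fst r) / (b - x\<^sub>1))) (n * infdist r (- \<Omega>))" for r
  have u1: "u p = 1" "u q = 1"
    using n x1 by (auto simp: u_def p_def q_def)
  have "concave_on \<Omega> u"
  proof -
    have "concave_on \<Omega> (\<lambda>r. (fst r - a) / (x\<^sub>1 - a))" "concave_on \<Omega> (\<lambda>r. (b - fst r) / (b - x\<^sub>1))"
      using concave_on_affine_fst[OF conv, of "- a / (x\<^sub>1 - a)" "1 / (x\<^sub>1 - a)"]
        concave_on_affine_fst[OF conv, of "b / (b - x\<^sub>1)" "- 1 / (b - x\<^sub>1)"]
      by (simp_all add: diff_divide_distrib)
    moreover have "concave_on \<Omega> (\<lambda>r. n * infdist r (- \<Omega>))"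
      using concave_on_infdist_complement[OF conv ne] n(1) by (intro concave_on_cmul) auto
    ultimately show ?thesis
      unfolding u_def[abs_def] by (intro concave_on_min)
  qed
  moreover have "continuous_on \<Omega> u"
    unfolding u_def[abs_def] using x1 by (intro continuous_intros) auto
  moreover have u0: "u r = 0" if "r \<in> frontier \<Omega>" for r
  proof -
    have "r \<in> closure (- \<Omega>)" using that by (simp add: frontier_closures)
    then have "infdist r (- \<Omega>) = 0" using in_closure_iff_infdist_zero[OF ne] by simp
    moreover have "r \<in> \<Omega>" using that compact_imp_closed[OF comp] by (auto simp: frontier_def)
    then have "fst r \<in> {a..b}" using ab by blast
    ultimately show ?thesis using x1 by (auto simp: u_def)
  qed
  moreover have "\<exists>M. \<forall>r\<in>interior \<Omega>. gradient_exists u r \<longrightarrow> norm (partial_x u r, partial_y u r) \<le> M"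
  proof -
    define K where "K = 1 / (x\<^sub>1 - a) + 1 / (b - x\<^sub>1) + n"
    have "\<bar>u r - u s\<bar> \<le> K * dist r s" for r s
    proof -
      have f: "\<bar>fst r - fst s\<bar> \<le> dist r s" using dist_fst_le[of r s] by (simp add: dist_real_def)
      have "\<bar>(fst r - a) / (x\<^sub>1 - a) - (fst s - a) / (x\<^sub>1 - a)\<bar> \<le> 1 / (x\<^sub>1 - a) * dist r s"
        "\<bar>(b - fst r) / (b - x\<^sub>1) - (b - fst s) / (b - x\<^sub>1)\<bar> \<le> 1 / (b - x\<^sub>1) * dist r s"
        using f x1 by (simp_all add: diff_divide_distrib[symmetric] divide_right_mono abs_minus_commute)
      moreover have "\<bar>n * infdist r (- \<Omega>) - n * infdist s (- \<Omega>)\<bar> \<le> n * dist r s"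
        using infdist_triangle_abs[of r "- \<Omega>" s] n(1)
        by (simp add: abs_mult flip: right_diff_distrib)
      ultimately show ?thesis
        unfolding u_def K_def distrib_right by linarith
    qed
    then show ?thesis using lipschitz_bounded_gradient by blast
  qed
  ultimately have U: "u \<in> U_class \<Omega>" by (simp add: U_class_def)
  define v where "v = zero_extension \<Omega> u"
  have v: "concave_bump \<Omega> v" unfolding v_def by (rule concave_bump_zero_extension[OF dom U])
  interpret concave_bump \<Omega> v by fact
  interpret M: concave_profile c d "ridge v" by (rule concave_profile_ridge[OF cd])
  interpret N: concave_profile a b "ridge (v \<circ> prod.swap)" by (rule concave_profile_ridge_swap[OF v ab])
  have in_\<Omega>: "p \<in> \<Omega>" "q \<in> \<Omega>" using p q interior_subset by auto
  have "1 \<le> ridge v (snd p)" "1 \<le> ridge v (snd q)"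
    using le_ridge[of "fst p" "snd p"] le_ridge[of "fst q" "snd q"] in_\<Omega> u1
    by (simp_all add: v_def zero_extension_def)
  moreover have "snd q - snd p = (1 - \<epsilon>) * (d - c)" by (simp add: p_def q_def algebra_simps)
  moreover have cd': "c < d" using box[OF p] by simp
  ultimately have "1 * (d - c + (1 - \<epsilon>) * (d - c)) / 2 \<le> integral\<^sup>L lborel (ridge v)"
    using M.two_point_lower_bound[of 1 "snd p" "snd q"] box[OF p] box[OF q] \<epsilon>
    by (smt (verit) mult_pos_pos)
  moreover have "(1 - \<epsilon>) * (d - c) \<le> 1 * (d - c)" using \<epsilon> cd' by (intro mult_right_mono) auto
  ultimately have I: "(1 - \<epsilon>) * (d - c) \<le> integral\<^sup>L lborel (ridge v)" by simp
  have J: "integral\<^sup>L lborel (ridge (v \<circ> prod.swap)) \<le> (b - a) / 2"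
  proof (rule N.tent_upper_bound[OF x1])
    interpret swapped: concave_bump "prod.swap ` \<Omega>" "v \<circ> prod.swap" by (rule concave_bump_swap[OF v])
    fix x assume x: "x \<in> {a..b}"
    have tent: "0 \<le> (x - a) / (x\<^sub>1 - a)" "0 \<le> (b - x) / (b - x\<^sub>1)" using x x1 by auto
    then have "v (x, y) \<le> (x - a) / (x\<^sub>1 - a)" "v (x, y) \<le> (b - x) / (b - x\<^sub>1)" for y
      by (auto simp: v_def zero_extension_def u_def)
    with tent show "ridge (v \<circ> prod.swap) x \<le> (x - a) / (x\<^sub>1 - a)" "ridge (v \<circ> prod.swap) x \<le> (b - x) / (b - x\<^sub>1)"
      by (auto intro: swapped.ridge_leI)
  qed
  show ?thesis
    using that[OF U in_\<Omega>(1)] u1 I J by (simp add: v_def)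
qed

section \<open>The circumscribed rectangle\<close>

lemma circumscribed_rectangle_projections:
  assumes dom: "convex_compact_domain \<Omega>" and circ: "circumscribed_rectangle \<Omega> a b"
  shows "fst ` \<Omega> = {fst a..fst b}" "snd ` \<Omega> = {snd a..snd b}" "fst a < fst b" "snd a < snd b"
proof -
  have \<Omega>: "convex \<Omega>" "compact \<Omega>" "interior \<Omega> \<noteq> {}"
    using dom by (auto simp: convex_compact_domain_def)
  have "connected (fst ` \<Omega>)" "compact (fst ` \<Omega>)" "connected (snd ` \<Omega>)" "compact (snd ` \<Omega>)"
    by (auto intro!: connected_continuous_image compact_continuous_image continuous_intros
        convex_connected[OF \<Omega>(1)] \<Omega>(2))
  then obtain l r s t where lr: "fst ` \<Omega> = {l..r}" and st: "snd ` \<Omega> = {s..t}"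
    using connected_compact_interval_1 by (metis box_real(2))
  obtain z where z: "z \<in> interior \<Omega>" using \<Omega>(3) by auto
  have strict: "l < r" "s < t" using interior_subset_open_box[OF lr st z] by auto
  have mem: "p \<in> cbox x y \<longleftrightarrow> fst x \<le> fst p \<and> fst p \<le> fst y \<and> snd x \<le> snd p \<and> snd p \<le> snd y"
    for p x y :: "real \<times> real"
    by (cases p; cases x; cases y) (auto simp: cbox_Pair_eq)
  have sub: "\<Omega> \<subseteq> cbox a b" using circ by (simp add: circumscribed_rectangle_def)
  have "\<Omega> \<subseteq> cbox (l, s) (r, t)" by (rule subset_cbox_projections[OF lr st])
  then have "cbox a b \<subseteq> cbox (l, s) (r, t)" using circ by (simp add: circumscribed_rectangle_def)
  moreover have "cbox a b \<noteq> {}" using z interior_subset[of \<Omega>] sub by auto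
  then have "a \<in> cbox a b" "b \<in> cbox a b" by (auto simp: mem intro: order_trans)
  ultimately have "a \<in> cbox (l, s) (r, t)" "b \<in> cbox (l, s) (r, t)" by auto
  then have in1: "l \<le> fst a" "fst b \<le> r" "s \<le> snd a" "snd b \<le> t" by (auto simp: mem)
  have "l \<in> fst ` \<Omega>" "r \<in> fst ` \<Omega>" "s \<in> snd ` \<Omega>" "t \<in> snd ` \<Omega>" using strict by (auto simp: lr st)
  then have "fst a \<le> l" "r \<le> fst b" "snd a \<le> s" "t \<le> snd b" using sub by (auto simp: subset_iff mem)
  with in1 have "l = fst a" "r = fst b" "s = snd a" "t = snd b" by auto
  then show "fst ` \<Omega> = {fst a..fst b}" "snd ` \<Omega> = {snd a..snd b}" "fst a < fst b" "snd a < snd b"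
    using lr st strict by auto
qed

lemma horizontal_segment_iff:
  fixes l r y :: real
  assumes "l \<le> r"
  shows "p \<in> closed_segment (l, y) (r, y) \<longleftrightarrow> snd p = y \<and> fst p \<in> {l..r}"
proof
  assume "p \<in> closed_segment (l, y) (r, y)"
  then obtain u where u: "0 \<le> u" "u \<le> 1" "p = (1 - u) *\<^sub>R (l, y) + u *\<^sub>R (r, y)"
    by (auto simp: in_segment)
  then have "fst p \<in> closed_segment l r" by (auto simp: in_segment)
  then show "snd p = y \<and> fst p \<in> {l..r}"
    using u assms by (auto simp: closed_segment_eq_real_ivl algebra_simps)
next
  assume p: "snd p = y \<and> fst p \<in> {l..r}"
  then have "fst p \<in> closed_segment l r" using assms by (simp add: closed_segment_eq_real_ivl)
  then obtain u where u: "0 \<le> u" "u \<le> 1" "fst p = (1 - u) *\<^sub>R l + u *\<^sub>R r"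
    by (auto simp: in_segment)
  have "p = (1 - u) *\<^sub>R (l, y) + u *\<^sub>R (r, y)"
    using u p by (intro prod_eqI) (auto simp: algebra_simps)
  then show "p \<in> closed_segment (l, y) (r, y)" using u by (auto simp: in_segment)
qed

lemma has_full_vertical_segment_iff:
  assumes dom: "convex_compact_domain \<Omega>" and circ: "circumscribed_rectangle \<Omega> a b"
  shows "has_full_vertical_segment \<Omega> a b \<longleftrightarrow> (\<exists>x. (x, snd a) \<in> \<Omega> \<and> (x, snd b) \<in> \<Omega>)"
proof -
  note box = circumscribed_rectangle_projections[OF dom circ]
  have conv: "convex \<Omega>" using dom by (simp add: convex_compact_domain_def)
  have h: "p \<in> closed_segment a (fst b, snd a) \<longleftrightarrow> snd p = snd a \<and> fst p \<in> {fst a..fst b}"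
    "p \<in> closed_segment (fst a, snd b) b \<longleftrightarrow> snd p = snd b \<and> fst p \<in> {fst a..fst b}" for p
    using horizontal_segment_iff[of "fst a" "fst b" p "snd a"]
      horizontal_segment_iff[of "fst a" "fst b" p "snd b"] box(3) by simp_all
  show ?thesis
  proof
    assume "has_full_vertical_segment \<Omega> a b"
    then obtain p q where "snd p = snd a" "snd q = snd b" "fst p = fst q" "closed_segment p q \<subseteq> \<Omega>"
      unfolding has_full_vertical_segment_def Bex_def h by auto
    then show "\<exists>x. (x, snd a) \<in> \<Omega> \<and> (x, snd b) \<in> \<Omega>"
      by (metis ends_in_segment prod.collapse subsetD)
  next
    assume "\<exists>x. (x, snd a) \<in> \<Omega> \<and> (x, snd b) \<in> \<Omega>"
    then obtain x where x: "(x, snd a) \<in> \<Omega>" "(x, snd b) \<in> \<Omega>" by blast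
    then have "x \<in> {fst a..fst b}" using box(1) by (metis fst_conv imageI)
    then show "has_full_vertical_segment \<Omega> a b"
      unfolding has_full_vertical_segment_def Bex_def h
      using closed_segment_subset[OF x conv] by (intro exI[of _ "(x, snd a)"] exI[of _ "(x, snd b)"] conjI) auto
  qed
qed

text \<open>
  The sum measures how far $p$ and $q$ are from being the ends of a full vertical segment; it is
  positive and, by compactness, attains its minimum.
\<close>

lemma no_full_segment_gap:
  fixes \<Omega> :: "(real \<times> real) set"
  assumes comp: "compact \<Omega>" and ne: "\<Omega> \<noteq> {}" and cd: "snd ` \<Omega> = {c..d}"
    and no: "\<nexists>x. (x, c) \<in> \<Omega> \<and> (x, d) \<in> \<Omega>"
  obtains \<delta> where "\<delta> > 0"
    "\<And>p q. p \<in> \<Omega> \<Longrightarrow> q \<in> \<Omega> \<Longrightarrow> \<delta> \<le> (snd p - c) + (d - snd q) + \<bar>fst p - fst q\<bar>"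
proof -
  define F where "F = (\<lambda>(p, q). (snd p - c) + (d - snd q) + \<bar>fst p - fst q\<bar> :: real)"
  have "continuous_on (\<Omega> \<times> \<Omega>) F"
    unfolding F_def case_prod_beta by (intro continuous_intros)
  then obtain w where w: "w \<in> \<Omega> \<times> \<Omega>" "\<And>w'. w' \<in> \<Omega> \<times> \<Omega> \<Longrightarrow> F w \<le> F w'"
    using continuous_attains_inf[OF compact_Times[OF comp comp], of F] ne by blast
  obtain p q where pq: "w = (p, q)" "p \<in> \<Omega>" "q \<in> \<Omega>" using w(1) by auto
  have "snd p \<in> {c..d}" "snd q \<in> {c..d}" using pq cd by (metis imageI)+
  moreover have "\<not> (snd p = c \<and> snd q = d \<and> fst p = fst q)"
    using no pq by (metis prod.collapse)
  ultimately have "0 < F w" by (auto simp: F_def pq(1))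
  then show ?thesis using that[of "F w"] w(2) by (force simp: F_def)
qed

section \<open>The sharp bound\<close>

theorem theorem1:
  fixes \<Omega> :: "(real \<times> real) set" and a b :: "real \<times> real" and w_x w_y :: real
  assumes "convex_compact_domain \<Omega>"
    and "circumscribed_rectangle \<Omega> a b"
    and "w_x = fst b - fst a"
    and "w_y = snd b - snd a"
  shows "K1 \<Omega> \<le> ereal (2 * (w_y / w_x)) \<and>
    (K1 \<Omega> = ereal (2 * (w_y / w_x)) \<longleftrightarrow> has_full_vertical_segment \<Omega> a b)"
proof -
  note dom = assms(1) and w = assms(3,4)
  note box = circumscribed_rectangle_projections[OF assms(1,2)]
  have wpos: "0 < w_x" "0 < w_y" using box w by auto
  let ?I = "\<lambda>u. integral\<^sup>L lborel (ridge (zero_extension \<Omega> u))"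
    and ?J = "\<lambda>u. integral\<^sup>L lborel (ridge (zero_extension \<Omega> u \<circ> prod.swap))"
  have quot: "L1_norm \<Omega> (partial_x u) / L1_norm \<Omega> (partial_y u) = ?I u / ?J u" if "u \<in> U_class \<Omega>" for u
    using L1_norms_eq_ridge_integrals[OF dom that] by simp
  have bounds: "0 < ?J u \<and> ?I u \<le> 2 * (w_y / w_x) * ?J u"
    if "u \<in> U_class \<Omega>" "p \<in> \<Omega>" "u p \<noteq> 0" for u p
  proof -
    have "zero_extension \<Omega> u p \<noteq> 0" using that by (simp add: zero_extension_def)
    from ridge_integral_ratio_bounds[OF concave_bump_zero_extension[OF dom that(1)] box(1,2) this]
    obtain m where m: "m > 0" "?I u \<le> m * w_y" "m * w_x / 2 \<le> ?J u"
      unfolding w by metis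
    have "0 < m * w_x / 2" using m wpos by simp
    then have "0 < ?J u" using m(3) by linarith
    moreover have "m * w_y = 2 * (w_y / w_x) * (m * w_x / 2)" using wpos by simp
    then have "m * w_y \<le> 2 * (w_y / w_x) * ?J u"
      using m(3) wpos by (metis mult_left_mono divide_nonneg_nonneg less_imp_le mult_nonneg_nonneg zero_le_numeral)
    ultimately show ?thesis using m(2) by linarith
  qed
  have le: "K1 \<Omega> \<le> ereal (2 * (w_y / w_x))"
    unfolding K1_def
  proof (rule SUP_least)
    fix u assume "u \<in> {u \<in> U_class \<Omega>. \<exists>p\<in>\<Omega>. u p \<noteq> 0}"
    then obtain p where u: "u \<in> U_class \<Omega>" "p \<in> \<Omega>" "u p \<noteq> 0" by blast
    have "?I u / ?J u \<le> 2 * (w_y / w_x)" using bounds[OF u] by (simp only: pos_divide_le_eq)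
    then show "ereal (L1_norm \<Omega> (partial_x u) / L1_norm \<Omega> (partial_y u)) \<le> ereal (2 * (w_y / w_x))"
      by (simp only: quot[OF u(1)] ereal_less_eq)
  qed
  have "K1 \<Omega> \<noteq> ereal (2 * (w_y / w_x))" if no: "\<nexists>x. (x, snd a) \<in> \<Omega> \<and> (x, snd b) \<in> \<Omega>"
  proof -
    have comp: "compact \<Omega>" "\<Omega> \<noteq> {}" using dom interior_subset[of \<Omega>] by (auto simp: convex_compact_domain_def)
    obtain \<delta> where \<delta>: "\<delta> > 0"
        "\<And>p q. p \<in> \<Omega> \<Longrightarrow> q \<in> \<Omega> \<Longrightarrow> \<delta> \<le> (snd p - snd a) + (snd b - snd q) + \<bar>fst p - fst q\<bar>"
      using no_full_segment_gap[OF comp box(2) no] by metis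
    obtain C where C: "C < 2 * (w_y / w_x)"
      "\<And>v p. concave_bump \<Omega> v \<Longrightarrow> v p \<noteq> 0 \<Longrightarrow>
        integral\<^sup>L lborel (ridge v) \<le> C * integral\<^sup>L lborel (ridge (v \<circ> prod.swap))"
      using no_full_segment_ratio_gap[OF box(1,3,2,4) \<delta>] unfolding w by metis
    have "K1 \<Omega> \<le> ereal C"
      unfolding K1_def
    proof (rule SUP_least)
      fix u assume "u \<in> {u \<in> U_class \<Omega>. \<exists>p\<in>\<Omega>. u p \<noteq> 0}"
      then obtain p where u: "u \<in> U_class \<Omega>" "p \<in> \<Omega>" "u p \<noteq> 0" by blast
      have "zero_extension \<Omega> u p \<noteq> 0" using u by (simp add: zero_extension_def)
      from C(2)[OF concave_bump_zero_extension[OF dom u(1)] this] bounds[OF u]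
      show "ereal (L1_norm \<Omega> (partial_x u) / L1_norm \<Omega> (partial_y u)) \<le> ereal C"
        by (simp add: quot[OF u(1)] divide_le_eq)
    qed
    also have "\<dots> < ereal (2 * (w_y / w_x))" using C(1) by simp
    finally show ?thesis by simp
  qed
  moreover have "ereal (2 * (w_y / w_x)) \<le> K1 \<Omega>" if seg: "(x, snd a) \<in> \<Omega>" "(x, snd b) \<in> \<Omega>" for x
  proof (rule ereal_le_epsilon2)
      fix e :: real assume e: "e > 0"
      define R where "R = 2 * (w_y / w_x)"
      have R: "R > 0" using wpos by (simp add: R_def)
      define \<epsilon> where "\<epsilon> = min (1 / 2) (e / R)"
      have \<epsilon>: "0 < \<epsilon>" "\<epsilon> < 1" "\<epsilon> * R \<le> e" using e R by (auto simp: \<epsilon>_def min_def field_simps)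
      obtain u p where u: "u \<in> U_class \<Omega>" "p \<in> \<Omega>" "u p \<noteq> 0" "(1 - \<epsilon>) * w_y \<le> ?I u" "?J u \<le> w_x / 2"
        using near_extremal_function[OF dom box(1,2) seg \<epsilon>(1,2)] unfolding w by metis
      have J: "0 < ?J u" using bounds[OF u(1-3)] by simp
      have "R - e \<le> (1 - \<epsilon>) * R" using \<epsilon>(3) by (simp add: algebra_simps)
      also have "\<dots> = ((1 - \<epsilon>) * w_y) / (w_x / 2)" using wpos by (simp add: R_def)
      also have "\<dots> \<le> ((1 - \<epsilon>) * w_y) / ?J u"
        using u(5) J \<epsilon> wpos by (intro divide_left_mono) auto
      also have "\<dots> \<le> ?I u / ?J u" using u(4) J by (intro divide_right_mono) auto
      finally have "ereal (R - e) \<le> ereal (L1_norm \<Omega> (partial_x u) / L1_norm \<Omega> (partial_y u))"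
        by (simp add: quot[OF u(1)])
      also have "\<dots> \<le> K1 \<Omega>" unfolding K1_def using u by (intro SUP_upper) auto
      finally have "ereal (R - e) \<le> K1 \<Omega>" .
      then show "ereal (2 * (w_y / w_x)) \<le> K1 \<Omega> + ereal e"
        unfolding R_def[symmetric] by (cases "K1 \<Omega>") auto
  qed
  ultimately show ?thesis
    using le has_full_vertical_segment_iff[OF assms(1,2)] by (metis antisym)
qed

end
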